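(* Consider two regular tetrahedra inscribed in the unit sphere of $\mathbb{R}^3$, and let $P$ be the convex hull of their eight vertices. The maximal possible volume of $P$ is the volume of the cube $C$ inscribed in the unit sphere; that is, $$ v(P)\le v(C)=\frac{8}{3\sqrt{3}} . $$
   Context: $v(\cdot)$ denotes Euclidean volume in $\mathbb{R}^3$. A polyhedron is inscribed in the unit sphere if all its vertices lie on the unit sphere. The maximum is taken over all pairs of regular tetrahedra inscribed in the (same) unit sphere. *)

theory Defs
  imports "HOL-Analysis.Analysis"
begin

definition vertices :: "(real ^ 3) set \<Rightarrow> (real ^ 3) set" where
  "vertices S = {x. x extreme_point_of S}"

definition inscribed_in_unit_sphere :: "(real ^ 3) set \<Rightarrow> bool" where
  "inscribed_in_unit_sphere S \<longleftrightarrow> polytope S \<and> vertices S \<subseteq> sphere 0 1"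

definition regular_tetrahedron :: "(real ^ 3) set \<Rightarrow> bool" where
  "regular_tetrahedron S \<longleftrightarrow>
     3 simplex S \<and>
     (\<exists>d. \<forall>x\<in>vertices S. \<forall>y\<in>vertices S. x \<noteq> y \<longrightarrow> dist x y = d)"

(* A cube is a similar copy of the unit cube; the vector 1 has all components equal to 1. *)
definition is_cube :: "(real ^ 3) set \<Rightarrow> bool" where
  "is_cube S \<longleftrightarrow>
     (\<exists>f p s. orthogonal_transformation f \<and> 0 < s \<and>
        S = (\<lambda>x. p + s *\<^sub>R f x) ` cbox (0 :: real ^ 3) 1)"

end

theory Submission
  imports Defs
begin

text \<open>Let \<open>A\<close> be the set of the four vectors \<open>(\<plusminus>1, \<plusminus>1, \<plusminus>1)\<close> with coordinate product \<open>1\<close>. Up to a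
common isometry and the factor \<open>1 / sqrt 3\<close>, the two tetrahedra have vertex sets \<open>A\<close> and \<open>-R A\<close>
for a rotation \<open>R\<close>; the cube is the case \<open>R = 1\<close>. The bound to prove is that the hull of
\<open>A \<union> -R A\<close> has volume at most \<open>8\<close>.

Composing \<open>R\<close> with the twelve rotations of \<open>A\<close> only relabels the second tetrahedron, so \<open>R\<close> may be
taken of maximal trace in its coset. Then \<open>R\<close> has a Cayley vector \<open>v\<close>, and maximality of the trace says
exactly that \<open>v\<close> lies in the octahedron \<open>\<bar>v$1\<bar> + \<bar>v$2\<bar> + \<bar>v$3\<bar> \<le> 1\<close>
(\<open>cayley_vector_in_octahedron\<close>). The linear map \<open>x \<mapsto> x + x \<times> v\<close>, of determinant \<open>1 + \<bar>v\<bar>\<^sup>2\<close>, clears all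
denominators: it sends the eight points to \<open>\<plusminus>a + a \<times> v\<close> with \<open>a \<in> A\<close>, and their hull, \<open>twin_hull v\<close>,
must have volume at most \<open>8 (1 + \<bar>v\<bar>\<^sup>2)\<close>.

The point of the proof is that for \<open>v\<close> inside the octahedron this polyhedron is still a bent cube. Its
boundary consists of six bent quadrilaterals, one for each ordered splitting of \<open>A\<close> into two pairs
\<open>{a, b}\<close> and \<open>{c, d}\<close>, with vertices \<open>a + a \<times> v\<close>, \<open>b + b \<times> v\<close>, \<open>-c + c \<times> v\<close>, \<open>-d + d \<times> v\<close>, folded along
one of its diagonals. If the fold is the diagonal from the first tetrahedron, the cone over the face from
the origin has the volume of a multiple of \<open>(c - d) \<bullet> R (c - d)\<close>, because the cross product of two vertices
of a regular tetrahedron is a multiple of the opposite edge; otherwise of \<open>(a - b) \<bullet> R (a - b)\<close>. By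
Cauchy-Schwarz both are largest when \<open>R\<close> fixes that edge, as it does for the cube, and the six
cones together have at most the volume of the cube.

The bent faces are found through supporting planes. Every point of the hull lies in the cone over the
vertices that touch some supporting plane \<open>{x. k \<bullet> x = 1}\<close>
(\<open>convex_hull_covered_by_contact_cones\<close>), so it suffices to know which vertices can touch a plane together:
never both \<open>a + a \<times> v\<close> and \<open>-a + a \<times> v\<close> (\<open>contacts_disjoint\<close>), never three vertices of one tetrahedron
(\<open>plus_contacts_not_facet\<close>), and in a bent face only triples on the correct side of the fold
(\<open>diagonal_contacts\<close>). These statements are about \<open>k\<close> and \<open>z = v \<times> k\<close> only, since
\<open>k \<bullet> (\<plusminus>a + a \<times> v) = z \<bullet> a \<plusminus> k \<bullet> a\<close>. They need \<open>v\<close> strictly inside the octahedron; the boundary case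
follows because the hulls for \<open>v\<close> are monotone under scaling (\<open>twin_hull_subset_scaled\<close>).\<close>

section \<open>Two opposite tetrahedra, sheared by a vector\<close>

definition std_tet :: "(real^3) set" where
  "std_tet = {vector [1,1,1], vector [1,-1,-1], vector [-1,1,-1], vector [-1,-1,1]}"

text \<open>With \<open>R\<close> the rotation of Cayley vector \<open>v\<close>, these are the images of \<open>a\<close> and \<open>-R a\<close> under the linear map
\<open>x \<mapsto> x + x \<times> v\<close>, which is \<open>plus_vertex v\<close> itself.\<close>

definition plus_vertex :: "real^3 \<Rightarrow> real^3 \<Rightarrow> real^3" where "plus_vertex v a = a + cross3 a v"
definition minus_vertex :: "real^3 \<Rightarrow> real^3 \<Rightarrow> real^3" where "minus_vertex v a = cross3 a v - a"

definition l1_norm :: "real^3 \<Rightarrow> real" where "l1_norm v = \<bar>v$1\<bar> + \<bar>v$2\<bar> + \<bar>v$3\<bar>"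

definition supports :: "real^3 \<Rightarrow> real^3 \<Rightarrow> bool" where
  "supports v k \<longleftrightarrow> (\<forall>a\<in>std_tet. k \<bullet> plus_vertex v a \<le> 1 \<and> k \<bullet> minus_vertex v a \<le> 1)"

text \<open>The labels in \<open>std_tet\<close> of the vertices that touch the plane \<open>{x. k \<bullet> x = 1}\<close>.\<close>

definition plus_contacts :: "real^3 \<Rightarrow> real^3 \<Rightarrow> (real^3) set" where
  "plus_contacts v k = {a\<in>std_tet. k \<bullet> plus_vertex v a = 1}"
definition minus_contacts :: "real^3 \<Rightarrow> real^3 \<Rightarrow> (real^3) set" where
  "minus_contacts v k = {a\<in>std_tet. k \<bullet> minus_vertex v a = 1}"

section \<open>Which vertices touch a supporting plane: coordinates\<close>

text \<open>Here \<open>(p, q, r)\<close> is \<open>v\<close> and \<open>z = v \<times> k\<close>. If both vertices labelled \<open>(1, 1, 1)\<close> touch the plane, then \<open>k\<close> has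
coordinate sum \<open>0\<close> and \<open>z\<close> has coordinate sum \<open>1\<close>. Let \<open>k3\<close> be the largest coordinate of \<open>k\<close> in absolute
value. The inequality for \<open>z3\<close> forces \<open>z1 + z2 \<ge> \<bar>k3\<bar>\<close>, whereas \<open>z1 + z2\<close> is the pairing of \<open>v\<close> with
a vector whose coordinates are at most \<open>\<bar>k3\<bar>\<close>, hence is smaller than \<open>\<bar>k3\<bar>\<close>.\<close>

lemma no_segment_contact_coords:
  fixes p q r :: real
  assumes "\<bar>p\<bar> + \<bar>q\<bar> + \<bar>r\<bar> < 1"
    and z: "z1 = q * k3 - r * k2" "z2 = r * k1 - p * k3" "z3 = p * k2 - q * k1"
    and k: "k1 + k2 + k3 = 0" and s: "z1 + z2 + z3 = 1"
    and b: "z1 + \<bar>k1\<bar> \<le> 1" "z2 + \<bar>k2\<bar> \<le> 1" "z3 + \<bar>k3\<bar> \<le> 1"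
  shows False
proof -
  have key: False
    if l: "\<bar>p\<bar> + \<bar>q\<bar> + \<bar>r\<bar> < 1" and c: "c1 + c2 + c3 = 0" and g: "\<bar>c1\<bar> \<le> \<bar>c3\<bar>" "\<bar>c2\<bar> \<le> \<bar>c3\<bar>"
      and s: "(q * c3 - r * c2) + (r * c1 - p * c3) + (p * c2 - q * c1) = 1"
      and b: "(p * c2 - q * c1) + \<bar>c3\<bar> \<le> 1"
    for p q r c1 c2 c3 :: real
  proof -
    have nz: "c3 \<noteq> 0"
    proof
      assume "c3 = 0"
      with g have "c1 = 0" "c2 = 0" by auto
      with \<open>c3 = 0\<close> s show False by simp
    qed
    have d: "\<bar>c1 - c2\<bar> \<le> \<bar>c3\<bar>" using c g by linarith
    have "\<bar>c3\<bar> \<le> q * c3 - p * c3 + r * (c1 - c2)" using s b by (simp add: algebra_simps)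
    also have "\<dots> \<le> \<bar>q\<bar> * \<bar>c3\<bar> + \<bar>p\<bar> * \<bar>c3\<bar> + \<bar>r\<bar> * \<bar>c3\<bar>"
    proof -
      have "q * c3 \<le> \<bar>q\<bar> * \<bar>c3\<bar>" "- (p * c3) \<le> \<bar>p\<bar> * \<bar>c3\<bar>"
        by (metis abs_ge_self abs_mult, metis abs_ge_minus_self abs_mult)
      moreover have "r * (c1 - c2) \<le> \<bar>r\<bar> * \<bar>c3\<bar>"
        by (metis abs_ge_self abs_ge_zero abs_mult d mult_left_mono order_trans)
      ultimately show ?thesis by linarith
    qed
    also have "\<dots> = (\<bar>p\<bar> + \<bar>q\<bar> + \<bar>r\<bar>) * \<bar>c3\<bar>" by (simp add: algebra_simps)
    also have "\<dots> < \<bar>c3\<bar>" using l nz by simp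
    finally show False by simp
  qed
  consider "\<bar>k1\<bar> \<le> \<bar>k3\<bar>" "\<bar>k2\<bar> \<le> \<bar>k3\<bar>" | "\<bar>k2\<bar> \<le> \<bar>k1\<bar>" "\<bar>k3\<bar> \<le> \<bar>k1\<bar>" | "\<bar>k3\<bar> \<le> \<bar>k2\<bar>" "\<bar>k1\<bar> \<le> \<bar>k2\<bar>"
    by linarith
  then show False
  proof cases
    case 1 then show False using key[of p q r k1 k2 k3] assms by simp
  next
    case 2 then show False using key[of q r p k2 k3 k1] assms by simp
  next
    case 3 then show False using key[of r p q k3 k1 k2] assms by simp
  qed
qed

text \<open>If the three vertices \<open>a + a \<times> v\<close> with \<open>a \<noteq> (1, 1, 1)\<close> touch the plane, then \<open>k + v \<times> k = (-1, -1, -1)\<close>. Pairing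
this with \<open>v\<close> and with \<open>k\<close> and comparing lengths determines the coordinate sum of \<open>k\<close>; it is so negative that
\<open>-a + a \<times> v\<close> for \<open>a = (1, 1, 1)\<close> would lie beyond the plane.\<close>

lemma no_facet_contact_coords:
  fixes p q r :: real
  assumes l: "\<bar>p\<bar> + \<bar>q\<bar> + \<bar>r\<bar> < 1"
    and z: "z1 = q * k3 - r * k2" "z2 = r * k1 - p * k3" "z3 = p * k2 - q * k1"
    and c: "z1 + k1 = -1" "z2 + k2 = -1" "z3 + k3 = -1"
    and b: "z1 + z2 + z3 - (k1 + k2 + k3) \<le> 1"
  shows False
proof -
  define \<kappa> where "\<kappa> = k1 + k2 + k3"
  have zk: "z1 * k1 + z2 * k2 + z3 * k3 = 0" unfolding z by (simp add: algebra_simps)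
  have zv: "z1 * p + z2 * q + z3 * r = 0" unfolding z by (simp add: algebra_simps)
  have z': "z1 = -1 - k1" "z2 = -1 - k2" "z3 = -1 - k3" using c by auto
  have kk: "k1^2 + k2^2 + k3^2 = - \<kappa>"
    using zk unfolding z' \<kappa>_def by (simp add: algebra_simps power2_eq_square)
  have kv: "k1 * p + k2 * q + k3 * r = - (p + q + r)"
    using zv unfolding z' by (simp add: algebra_simps)
  have zz: "z1^2 + z2^2 + z3^2 = 3 + \<kappa>"
    using kk unfolding z' \<kappa>_def by (simp add: algebra_simps power2_eq_square)
  have "z1^2 + z2^2 + z3^2 = (p^2 + q^2 + r^2) * (k1^2 + k2^2 + k3^2) - (k1 * p + k2 * q + k3 * r)^2"
    unfolding z by (simp add: algebra_simps power2_eq_square)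
  then have e: "3 + (p + q + r)^2 = - \<kappa> * (1 + (p^2 + q^2 + r^2))"
    unfolding zz kk kv by (simp add: algebra_simps power2_eq_square)
  have "- \<kappa> \<le> 2" using b z' \<kappa>_def by simp
  then have "3 + (p + q + r)^2 \<le> 2 * (1 + (p^2 + q^2 + r^2))"
    unfolding e by (intro mult_right_mono) auto
  then have "1 \<le> p^2 + q^2 + r^2 - 2 * (p * q) - 2 * (q * r) - 2 * (r * p)"
    by (simp add: algebra_simps power2_eq_square)
  also have "\<dots> \<le> \<bar>p\<bar>^2 + \<bar>q\<bar>^2 + \<bar>r\<bar>^2 + 2 * (\<bar>p\<bar> * \<bar>q\<bar>) + 2 * (\<bar>q\<bar> * \<bar>r\<bar>) + 2 * (\<bar>r\<bar> * \<bar>p\<bar>)"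
  proof -
    have m: "- (x * y) \<le> \<bar>x\<bar> * \<bar>y\<bar>" for x y :: real by (metis abs_ge_minus_self abs_mult)
    show ?thesis using m[of p q] m[of q r] m[of r p] by (simp add: power2_abs)
  qed
  also have "\<dots> = (\<bar>p\<bar> + \<bar>q\<bar> + \<bar>r\<bar>)^2" by (simp add: algebra_simps power2_eq_square)
  also have "\<dots> < 1" using l by (simp add: abs_square_less_1)
  finally show False by simp
qed

text \<open>In the face with normal direction \<open>(1, 0, 0)\<close>, with plus labels \<open>(1, 1, 1)\<close> and \<open>(1, -1, -1)\<close>, three touching
vertices on one side of the plus diagonal force \<open>q r \<le> 0\<close>: the sign of \<open>q r\<close> decides along which diagonal the face is
folded. In the borderline case \<open>q r = 0\<close> the face is plane and the fourth vertex touches as well. The quantity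
\<open>m = 1 - k1\<close> is a quarter of the slack of the fourth vertex.\<close>

lemma diagonal_contact_coords:
  fixes p q r :: real
  assumes l: "\<bar>p\<bar> + \<bar>q\<bar> + \<bar>r\<bar> < 1"
    and z: "z1 = q * k3 - r * k2" "z2 = r * k1 - p * k3" "z3 = p * k2 - q * k1"
    and c1: "(z1 + z2 + z3) + (k1 + k2 + k3) = 1"
    and c2: "(z1 - z2 - z3) + (k1 - k2 - k3) = 1"
    and c3: "(- z1 + z2 - z3) - (- k1 + k2 - k3) = 1"
    and c4: "(- z1 - z2 + z3) - (- k1 - k2 + k3) \<le> 1"
    and n1: "(z1 + z2 + z3) - (k1 + k2 + k3) < 1"
    and n2: "(z1 - z2 - z3) - (k1 - k2 - k3) < 1"
    and n3: "(- z1 + z2 - z3) + (- k1 + k2 - k3) < 1"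
  shows "q * r < 0 \<or> q * r = 0 \<and> (- z1 - z2 + z3) - (- k1 - k2 + k3) = 1"
proof -
  define m where "m = 1 - k1"
  have m0: "0 \<le> m" using c1 c2 c3 c4 unfolding m_def by linarith
  have e1: "z1 = m" and e2: "z2 = m - k3" and e3: "z3 = - m - k2"
    using c1 c2 c3 unfolding m_def by linarith+
  have zk: "z1 * k1 + z2 * k2 + z3 * k3 = 0" unfolding z by (simp add: algebra_simps)
  have zv: "z1 * p + z2 * q + z3 * r = 0" unfolding z by (simp add: algebra_simps)
  have f1: "2 * (k2 * k3) = m * (k1 + k2 - k3)"
    using zk unfolding e1 e2 e3 by (simp add: algebra_simps)
  have g1: "q * k3 + r * k2 = m * (p + q - r)"
    using zv unfolding e1 e2 e3 by (simp add: algebra_simps)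
  have g2: "q * k3 - r * k2 = m" using z(1) e1 by simp
  have qk: "2 * (q * k3) = m * (1 + p + q - r)" and rk: "2 * (r * k2) = - (m * (1 - p - q + r))"
    using g1 g2 by (simp_all add: algebra_simps)
  have h2: "r * k1 - p * k3 = m - k3" and h3: "p * k2 - q * k1 = - m - k2"
    using z e2 e3 by simp_all
  have k1pos: "0 < k1" using c1 c2 n1 n2 by linarith
  have k4: "k2 - k3 < k1" using c3 n3 by linarith
  have c4eq: "(- z1 - z2 + z3) - (- k1 - k2 + k3) = 1 \<longleftrightarrow> m = 0"
    unfolding e1 e2 e3 m_def by auto
  have pos: "0 < 1 + p + q - r" "0 < 1 - p - q + r" using l by linarith+
  show ?thesis
  proof (cases "m = 0")
    case True
    have "q * r = 0"
    proof (rule ccontr)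
      assume "q * r \<noteq> 0"
      then have "k3 = 0" "k2 = 0" using qk rk True by auto
      then show False using h3 True k1pos \<open>q * r \<noteq> 0\<close> by simp
    qed
    then show ?thesis using True c4eq by simp
  next
    case False
    with m0 have mpos: "0 < m" by simp
    have Q: "0 < q * k3" and R: "r * k2 < 0" 
      using qk rk mult_pos_pos[OF mpos pos(1)] mult_pos_pos[OF mpos pos(2)] by linarith+
    \<comment> \<open>For \<open>q, r > 0\<close> the equations make \<open>m\<close> a combination of two numbers below \<open>m / (1 - \<bar>p\<bar>)\<close> with weights
      \<open>q\<close> and \<open>r\<close>, too small because \<open>q + r < 1 - \<bar>p\<bar>\<close>; for \<open>q, r < 0\<close> the sign in \<open>f1\<close> is wrong.\<close>
    have "\<not> 0 \<le> q * r"
    proof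
      assume "0 \<le> q * r"
      moreover have "q \<noteq> 0" "r \<noteq> 0" using Q R by auto
      ultimately consider "q > 0" "r > 0" | "q < 0" "r < 0"
        by (metis linorder_neqE_linordered_idom mult_neg_pos mult_pos_neg not_less)
      then show False
      proof cases
        case 1
        then have c: "k3 > 0" and b: "k2 < 0" using Q R
          by (simp_all add: zero_less_mult_iff mult_less_0_iff)
        define C where "C = k3" define B where "B = - k2"
        have cb: "C > 0" "B > 0" using c b C_def B_def by auto
        have "C * (1 - p) = m - r * k1" using h2 C_def by (simp add: algebra_simps)
        then have C1: "C * (1 - p) < m" using mult_pos_pos[OF 1(2) k1pos] by linarith
        have "B * (1 + p) = m - q * k1" using h3 B_def by (simp add: algebra_simps)
        then have B1: "B * (1 + p) < m" using mult_pos_pos[OF 1(1) k1pos] by linarith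
        have "\<bar>p\<bar> < 1" using l by linarith
        have C2: "C * (1 - \<bar>p\<bar>) < m"
          using C1 mult_left_mono[of "1 - \<bar>p\<bar>" "1 - p" C] cb by linarith
        have B2: "B * (1 - \<bar>p\<bar>) < m"
          using B1 mult_left_mono[of "1 - \<bar>p\<bar>" "1 + p" B] cb by linarith
        have "m * (1 - \<bar>p\<bar>) = q * (C * (1 - \<bar>p\<bar>)) + r * (B * (1 - \<bar>p\<bar>))"
          unfolding g2[symmetric] C_def B_def by (simp add: algebra_simps)
        also have "\<dots> < q * m + r * m"
          using mult_strict_left_mono[OF C2 1(1)] mult_strict_left_mono[OF B2 1(2)] by linarith
        also have "\<dots> = m * (q + r)" by (simp add: algebra_simps)
        also have "\<dots> < m * (1 - \<bar>p\<bar>)"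
          using mult_strict_left_mono[of "q + r" "1 - \<bar>p\<bar>" m] l 1 mpos by simp
        finally show False .
      next
        case 2
        then have c: "k3 < 0" and b: "k2 > 0" using Q R
          by (simp_all add: zero_less_mult_iff mult_less_0_iff)
        have "k2 * k3 < 0" using c b by (simp add: mult_pos_neg)
        then have "m * (k1 + k2 - k3) < 0" using f1 by linarith
        moreover have "0 < k1 + k2 - k3" using k1pos c b by linarith
        ultimately show False using mpos by (simp add: mult_less_0_iff)
      qed
    qed
    then show ?thesis by simp
  qed
qed

section \<open>Which vertices touch a supporting plane: vectors\<close>

lemma inner_plus_vertex: "k \<bullet> plus_vertex v a = cross3 v k \<bullet> a + k \<bullet> a"
  and inner_minus_vertex: "k \<bullet> minus_vertex v a = cross3 v k \<bullet> a - k \<bullet> a"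
  by (simp_all add: plus_vertex_def minus_vertex_def cross3_simps)

lemma inner_sign_vector: "(x::real^3) \<bullet> vector [e1, e2, e3] = e1 * x$1 + e2 * x$2 + e3 * (x$3::real)"
  by (simp add: inner_vec_def sum_3)

lemma vector3_eq_iff: "vector [a, b, c] = (vector [a', b', c'] :: real^3) \<longleftrightarrow> a = a' \<and> b = b' \<and> c = c'"
  by (auto simp: vec_eq_iff forall_3)

text \<open>The four labels are exchanged by sign changes of two coordinates. These act on \<open>v\<close>, \<open>k\<close> and \<open>z\<close> simultaneously,
so the case of the label \<open>(1, 1, 1)\<close> is instantiated with the corresponding signs.\<close>

lemma contacts_disjoint:
  assumes "l1_norm v < 1" "supports v k"
  shows "plus_contacts v k \<inter> minus_contacts v k = {}"
proof -
  define z where "z = cross3 v k"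
  have z: "z$1 = v$2 * k$3 - v$3 * k$2" "z$2 = v$3 * k$1 - v$1 * k$3" "z$3 = v$1 * k$2 - v$2 * k$1"
    by (simp_all add: z_def cross_components)
  have H: "z \<bullet> a + k \<bullet> a \<le> 1" "z \<bullet> a - k \<bullet> a \<le> 1" if "a \<in> std_tet" for a
    using assms(2) that unfolding supports_def inner_plus_vertex inner_minus_vertex z_def[symmetric] by blast+
  have H': "z$1 + z$2 + z$3 + (k$1 + k$2 + k$3) \<le> 1" "z$1 - z$2 - z$3 + (k$1 - k$2 - k$3) \<le> 1"
    "- z$1 + z$2 - z$3 + (- k$1 + k$2 - k$3) \<le> 1" "- z$1 - z$2 + z$3 + (- k$1 - k$2 + k$3) \<le> 1"
    "z$1 + z$2 + z$3 - (k$1 + k$2 + k$3) \<le> 1" "z$1 - z$2 - z$3 - (k$1 - k$2 - k$3) \<le> 1"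
    "- z$1 + z$2 - z$3 - (- k$1 + k$2 - k$3) \<le> 1" "- z$1 - z$2 + z$3 - (- k$1 - k$2 + k$3) \<le> 1"
    using H[of "vector [1,1,1]"] H[of "vector [1,-1,-1]"] H[of "vector [-1,1,-1]"] H[of "vector [-1,-1,1]"]
    by (simp_all add: std_tet_def inner_sign_vector)
  have l: "\<bar>v$1\<bar> + \<bar>v$2\<bar> + \<bar>v$3\<bar> < 1" using assms(1) by (simp add: l1_norm_def)
  have False if "a \<in> plus_contacts v k" "a \<in> minus_contacts v k" for a
  proof -
    have a: "z \<bullet> a = 1" "k \<bullet> a = 0" "a \<in> std_tet"
      using that by (auto simp: plus_contacts_def minus_contacts_def inner_plus_vertex inner_minus_vertex z_def)
    from a(3) consider "a = vector [1,1,1]" | "a = vector [1,-1,-1]" | "a = vector [-1,1,-1]" | "a = vector [-1,-1,1]"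
      unfolding std_tet_def by blast
    then show False
    proof cases
      case 1
      with a have e: "z$1 + z$2 + z$3 = 1" "k$1 + k$2 + k$3 = 0" by (simp_all add: inner_sign_vector)
      show False
        by (rule no_segment_contact_coords[of "v$1" "v$2" "v$3" "z$1" "k$3" "k$2" "z$2" "k$1" "z$3"]; ((insert l; simp; fail) | (insert e H' z; linarith)))
    next
      case 2
      with a have e: "z$1 - z$2 - z$3 = 1" "k$1 - k$2 - k$3 = 0" by (simp_all add: inner_sign_vector)
      show False
        by (rule no_segment_contact_coords[of "v$1" "-v$2" "-v$3" "z$1" "-k$3" "-k$2" "-z$2" "k$1" "-z$3"]; ((insert l; simp; fail) | (insert e H' z; linarith)))
    next
      case 3
      with a have e: "- z$1 + z$2 - z$3 = 1" "- k$1 + k$2 - k$3 = 0" by (simp_all add: inner_sign_vector)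
      show False
        by (rule no_segment_contact_coords[of "-v$1" "v$2" "-v$3" "-z$1" "-k$3" "k$2" "z$2" "-k$1" "-z$3"]; ((insert l; simp; fail) | (insert e H' z; linarith)))
    next
      case 4
      with a have e: "- z$1 - z$2 + z$3 = 1" "- k$1 - k$2 + k$3 = 0" by (simp_all add: inner_sign_vector)
      show False
        by (rule no_segment_contact_coords[of "-v$1" "-v$2" "v$3" "-z$1" "k$3" "-k$2" "-z$2" "-k$1" "z$3"]; ((insert l; simp; fail) | (insert e H' z; linarith)))
    qed
  qed
  then show ?thesis by blast
qed

text \<open>Replacing \<open>v\<close> and \<open>k\<close> by their negatives reflects the configuration in the origin and thereby exchanges the roles of
the two tetrahedra.\<close>

lemma supports_uminus: "supports (-v) (-k) \<longleftrightarrow> supports v k"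
  and plus_contacts_uminus: "plus_contacts (-v) (-k) = minus_contacts v k"
  and l1_norm_uminus: "l1_norm (-v) = l1_norm v"
  by (auto simp: supports_def plus_contacts_def minus_contacts_def inner_plus_vertex inner_minus_vertex l1_norm_def)

lemma plus_contacts_not_facet:
  assumes "l1_norm v < 1" "supports v k" "a \<in> std_tet"
  shows "\<not> std_tet - {a} \<subseteq> plus_contacts v k"
proof
  assume C: "std_tet - {a} \<subseteq> plus_contacts v k"
  define z where "z = cross3 v k"
  have z: "z$1 = v$2 * k$3 - v$3 * k$2" "z$2 = v$3 * k$1 - v$1 * k$3" "z$3 = v$1 * k$2 - v$2 * k$1"
    by (simp_all add: z_def cross_components)
  have l: "\<bar>v$1\<bar> + \<bar>v$2\<bar> + \<bar>v$3\<bar> < 1" using assms(1) by (simp add: l1_norm_def)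
  have m: "z \<bullet> a - k \<bullet> a \<le> 1"
    using assms(2,3) unfolding supports_def inner_plus_vertex inner_minus_vertex z_def[symmetric] by blast
  have c: "z \<bullet> b + k \<bullet> b = 1" if "b \<in> std_tet" "b \<noteq> a" for b
    using C that by (auto simp: plus_contacts_def inner_plus_vertex z_def)
  from assms(3) consider "a = vector [1,1,1]" | "a = vector [1,-1,-1]" | "a = vector [-1,1,-1]" | "a = vector [-1,-1,1]"
    unfolding std_tet_def by blast
  then show False
  proof cases
    case 1
    have e: "z$1 - z$2 - z$3 + (k$1 - k$2 - k$3) = 1" "- z$1 + z$2 - z$3 + (- k$1 + k$2 - k$3) = 1" "- z$1 - z$2 + z$3 + (- k$1 - k$2 + k$3) = 1"
      "z$1 + z$2 + z$3 - (k$1 + k$2 + k$3) \<le> 1"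
      using c[of "vector [1,-1,-1]"] c[of "vector [-1,1,-1]"] c[of "vector [-1,-1,1]"] m 1 by (simp_all add: inner_sign_vector vector3_eq_iff std_tet_def)
    show False
      by (rule no_facet_contact_coords[of "v$1" "v$2" "v$3" "z$1" "k$3" "k$2" "z$2" "k$1" "z$3"]; ((insert l; simp; fail) | (insert e z; linarith)))
  next
    case 2
    have e: "z$1 + z$2 + z$3 + (k$1 + k$2 + k$3) = 1" "- z$1 + z$2 - z$3 + (- k$1 + k$2 - k$3) = 1" "- z$1 - z$2 + z$3 + (- k$1 - k$2 + k$3) = 1"
      "z$1 - z$2 - z$3 - (k$1 - k$2 - k$3) \<le> 1"
      using c[of "vector [1,1,1]"] c[of "vector [-1,1,-1]"] c[of "vector [-1,-1,1]"] m 2 by (simp_all add: inner_sign_vector vector3_eq_iff std_tet_def)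
    show False
      by (rule no_facet_contact_coords[of "v$1" "-v$2" "-v$3" "z$1" "-k$3" "-k$2" "-z$2" "k$1" "-z$3"]; ((insert l; simp; fail) | (insert e z; linarith)))
  next
    case 3
    have e: "z$1 + z$2 + z$3 + (k$1 + k$2 + k$3) = 1" "z$1 - z$2 - z$3 + (k$1 - k$2 - k$3) = 1" "- z$1 - z$2 + z$3 + (- k$1 - k$2 + k$3) = 1"
      "- z$1 + z$2 - z$3 - (- k$1 + k$2 - k$3) \<le> 1"
      using c[of "vector [1,1,1]"] c[of "vector [1,-1,-1]"] c[of "vector [-1,-1,1]"] m 3 by (simp_all add: inner_sign_vector vector3_eq_iff std_tet_def)
    show False
      by (rule no_facet_contact_coords[of "-v$1" "v$2" "-v$3" "-z$1" "-k$3" "k$2" "z$2" "-k$1" "-z$3"]; ((insert l; simp; fail) | (insert e z; linarith)))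
  next
    case 4
    have e: "z$1 + z$2 + z$3 + (k$1 + k$2 + k$3) = 1" "z$1 - z$2 - z$3 + (k$1 - k$2 - k$3) = 1" "- z$1 + z$2 - z$3 + (- k$1 + k$2 - k$3) = 1"
      "- z$1 - z$2 + z$3 - (- k$1 - k$2 + k$3) \<le> 1"
      using c[of "vector [1,1,1]"] c[of "vector [1,-1,-1]"] c[of "vector [-1,1,-1]"] m 4 by (simp_all add: inner_sign_vector vector3_eq_iff std_tet_def)
    show False
      by (rule no_facet_contact_coords[of "-v$1" "-v$2" "v$3" "-z$1" "k$3" "-k$2" "-z$2" "-k$1" "z$3"]; ((insert l; simp; fail) | (insert e z; linarith)))
  qed
qed

lemma minus_contacts_not_facet:
  assumes "l1_norm v < 1" "supports v k" "a \<in> std_tet"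
  shows "\<not> std_tet - {a} \<subseteq> minus_contacts v k"
  using plus_contacts_not_facet[of "-v" "-k" a] assms by (simp add: supports_uminus plus_contacts_uminus l1_norm_uminus)

section \<open>Cones over quadrilaterals and their volumes\<close>

lemma convex_sum_four_with_zero:
  fixes C :: "'a::real_vector set"
  assumes "convex C" "0 \<in> C" "x1 \<in> C" "x2 \<in> C" "x3 \<in> C" "x4 \<in> C"
    and "0 \<le> c1" "0 \<le> c2" "0 \<le> c3" "0 \<le> c4" "c1 + c2 + c3 + c4 \<le> (1::real)"
  shows "c1 *\<^sub>R x1 + c2 *\<^sub>R x2 + c3 *\<^sub>R x3 + c4 *\<^sub>R x4 \<in> C"
proof -
  define c where "c = (\<lambda>i::nat. [c1, c2, c3, c4, 1 - (c1 + c2 + c3 + c4)] ! i)"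
  define y where "y = (\<lambda>i::nat. [x1, x2, x3, x4, 0] ! i)"
  have "(\<Sum>i<5. c i *\<^sub>R y i) \<in> C"
    using assms
    by (intro convex_sum) (auto simp: c_def y_def eval_nat_numeral lessThan_Suc less_Suc_eq)
  then show ?thesis by (simp add: c_def y_def eval_nat_numeral lessThan_Suc algebra_simps)
qed

lemma convex_hull_zero_four:
  fixes x1 x2 x3 x4 :: "'a::real_vector"
  assumes "x \<in> convex hull {0, x1, x2, x3, x4}"
  obtains c1 c2 c3 c4 where "0 \<le> c1" "0 \<le> c2" "0 \<le> c3" "0 \<le> c4" "c1 + c2 + c3 + c4 \<le> (1::real)"
    "x = c1 *\<^sub>R x1 + c2 *\<^sub>R x2 + c3 *\<^sub>R x3 + c4 *\<^sub>R x4"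
proof -
  define D where "D = {c1 *\<^sub>R x1 + c2 *\<^sub>R x2 + c3 *\<^sub>R x3 + c4 *\<^sub>R x4 | c1 c2 c3 c4.
    0 \<le> c1 \<and> 0 \<le> c2 \<and> 0 \<le> c3 \<and> 0 \<le> c4 \<and> c1 + c2 + c3 + c4 \<le> (1::real)}"
  have DI: "c1 *\<^sub>R x1 + c2 *\<^sub>R x2 + c3 *\<^sub>R x3 + c4 *\<^sub>R x4 \<in> D"
    if "0 \<le> c1" "0 \<le> c2" "0 \<le> c3" "0 \<le> c4" "c1 + c2 + c3 + c4 \<le> (1::real)" for c1 c2 c3 c4
    using that unfolding D_def by blast
  have "convex D"
  proof (rule convexI)
    fix y z and u w :: real
    assume y: "y \<in> D" and z: "z \<in> D" and uw: "0 \<le> u" "0 \<le> w" "u + w = 1"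
    obtain c1 c2 c3 c4 where c: "0 \<le> c1" "0 \<le> c2" "0 \<le> c3" "0 \<le> c4" "c1 + c2 + c3 + c4 \<le> (1::real)"
      and y: "y = c1 *\<^sub>R x1 + c2 *\<^sub>R x2 + c3 *\<^sub>R x3 + c4 *\<^sub>R x4" using y unfolding D_def by blast
    obtain d1 d2 d3 d4 where d: "0 \<le> d1" "0 \<le> d2" "0 \<le> d3" "0 \<le> d4" "d1 + d2 + d3 + d4 \<le> (1::real)"
      and z: "z = d1 *\<^sub>R x1 + d2 *\<^sub>R x2 + d3 *\<^sub>R x3 + d4 *\<^sub>R x4" using z unfolding D_def by blast
    have "u * (c1 + c2 + c3 + c4) + w * (d1 + d2 + d3 + d4) \<le> u * 1 + w * 1"
      using c d uw by (intro add_mono mult_left_mono) auto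
    then have "(u*c1+w*d1) *\<^sub>R x1 + (u*c2+w*d2) *\<^sub>R x2 + (u*c3+w*d3) *\<^sub>R x3 + (u*c4+w*d4) *\<^sub>R x4 \<in> D"
      using c d uw by (intro DI) (auto simp: algebra_simps)
    then show "u *\<^sub>R y + w *\<^sub>R z \<in> D" by (simp add: y z algebra_simps)
  qed
  moreover have "{0, x1, x2, x3, x4} \<subseteq> D"
    using DI[of 0 0 0 0] DI[of 1 0 0 0] DI[of 0 1 0 0] DI[of 0 0 1 0] DI[of 0 0 0 1] by auto
  ultimately have "x \<in> D" using assms hull_minimal[of _ D convex] by blast
  then show ?thesis unfolding D_def using that by blast
qed

text \<open>The relation says that the segments from \<open>x1\<close> to \<open>x2\<close> and from \<open>x3\<close> to \<open>x4\<close> cross. Adding a multiple of it to a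
combination of the four points moves weight from \<open>x3, x4\<close> to \<open>x1, x2\<close> until \<open>x3\<close> or \<open>x4\<close> is used up.\<close>

lemma quadrilateral_split:
  fixes x1 x2 x3 x4 :: "'a::real_vector"
  assumes pos: "0 < s" "0 < t" "0 < u" "0 < (w::real)" and st: "s + t = u + w"
    and rel: "s *\<^sub>R x1 + t *\<^sub>R x2 = u *\<^sub>R x3 + w *\<^sub>R x4"
  shows "convex hull {0, x1, x2, x3, x4} \<subseteq> convex hull {0, x1, x2, x3} \<union> convex hull {0, x1, x2, x4}"
proof
  fix x assume "x \<in> convex hull {0, x1, x2, x3, x4}"
  then obtain c1 c2 c3 c4 where c: "0 \<le> c1" "0 \<le> c2" "0 \<le> c3" "0 \<le> c4" "c1 + c2 + c3 + c4 \<le> (1::real)"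
    and x: "x = c1 *\<^sub>R x1 + c2 *\<^sub>R x2 + c3 *\<^sub>R x3 + c4 *\<^sub>R x4"
    by (rule convex_hull_zero_four)
  have x': "x = (c1 + \<tau> * s) *\<^sub>R x1 + (c2 + \<tau> * t) *\<^sub>R x2 + (c3 - \<tau> * u) *\<^sub>R x3 + (c4 - \<tau> * w) *\<^sub>R x4" for \<tau>
  proof -
    have "\<tau> *\<^sub>R (s *\<^sub>R x1 + t *\<^sub>R x2) = \<tau> *\<^sub>R (u *\<^sub>R x3 + w *\<^sub>R x4)" using rel by simp
    then show ?thesis by (simp add: x algebra_simps)
  qed
  have S: "(c1 + \<tau> * s) + (c2 + \<tau> * t) + (c3 - \<tau> * u) + (c4 - \<tau> * w) \<le> 1" for \<tau>
  proof -
    have "\<tau> * s + \<tau> * t = \<tau> * u + \<tau> * w" using st by (metis distrib_left)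
    then show ?thesis using c by linarith
  qed
  have sub: "{0,x1,x2,y} \<subseteq> convex hull {0,x1,x2,y}" for y by (rule hull_subset)
  show "x \<in> convex hull {0, x1, x2, x3} \<union> convex hull {0, x1, x2, x4}"
  proof (cases "c3 / u \<le> c4 / w")
    case True
    define \<tau> where "\<tau> = c3 / u"
    have t: "0 \<le> \<tau>" "c3 - \<tau> * u = 0" "0 \<le> c4 - \<tau> * w"
      using True pos c by (auto simp: \<tau>_def field_simps)
    have "(c1 + \<tau> * s) *\<^sub>R x1 + (c2 + \<tau> * t) *\<^sub>R x2 + (c3 - \<tau> * u) *\<^sub>R 0 + (c4 - \<tau> * w) *\<^sub>R x4 \<in> convex hull {0,x1,x2,x4}"
      by (rule convex_sum_four_with_zero) (use c t pos S[of \<tau>] sub[of x4] in auto)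
    then show ?thesis using x'[of \<tau>] t by simp
  next
    case False
    define \<tau> where "\<tau> = c4 / w"
    have t: "0 \<le> \<tau>" "c4 - \<tau> * w = 0" "0 \<le> c3 - \<tau> * u"
      using False pos c by (auto simp: \<tau>_def field_simps)
    have "(c1 + \<tau> * s) *\<^sub>R x1 + (c2 + \<tau> * t) *\<^sub>R x2 + (c3 - \<tau> * u) *\<^sub>R x3 + (c4 - \<tau> * w) *\<^sub>R 0 \<in> convex hull {0,x1,x2,x3}"
      by (rule convex_sum_four_with_zero) (use c t pos S[of \<tau>] sub[of x3] in auto)
    then show ?thesis using x'[of \<tau>] t by simp
  qed
qed

lemma lmeasurable_hull_finite: "finite S \<Longrightarrow> convex hull S \<in> lmeasurable" for S :: "(real^3) set"
  by (simp add: finite_imp_compact_convex_hull lmeasurable_compact)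

lemma measure_tetrahedron_zero:
  fixes x y z :: "real^3"
  shows "measure lebesgue (convex hull {0, x, y, z}) = \<bar>x \<bullet> cross3 y z\<bar> / 6"
proof -
  define f where "f = (\<lambda>u::real^3. u$1 *\<^sub>R x + u$2 *\<^sub>R y + u$3 *\<^sub>R z)"
  have lin: "linear f"
    by (rule linearI) (simp_all add: f_def algebra_simps)
  have B: "Basis = {axis 1 1, axis 2 1, axis 3 (1::real) :: real^3}"
    by (auto simp: Basis_vec_def UNIV_3)
  have img: "f ` insert 0 Basis = {0, x, y, z}"
    by (simp add: B f_def axis_def)
  have d: "det (matrix f) = x \<bullet> cross3 y z"
    by (simp add: det_3 matrix_def f_def axis_def cross3_simps)
  have "convex hull {0, x, y, z} = f ` (convex hull (insert 0 Basis))"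
    unfolding img[symmetric] by (rule convex_hull_linear_image[OF lin, symmetric])
  then have "measure lebesgue (convex hull {0, x, y, z}) = \<bar>det (matrix f)\<bar> * measure lebesgue (convex hull (insert (0::real^3) Basis))"
    using measure_linear_image[OF lin lmeasurable_hull_finite[of "insert 0 Basis"]] by simp
  also have "measure lebesgue (convex hull (insert (0::real^3) Basis)) = measure lborel (convex hull (insert (0::real^3) Basis))"
    by (rule measure_completion) (simp add: finite_imp_compact_convex_hull borel_compact)
  also have "\<dots> = 1 / 6"
    by (subst content_std_simplex) (simp add: fact_numeral)
  finally show ?thesis by (simp add: d)
qed

text \<open>The cone from the origin over the bent face in direction \<open>(1, 0, 0)\<close>, as the two tetrahedra on either side of its fold.
The third, degenerate hull has volume zero; it takes up points for which only the two ends of the other diagonal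
touch.\<close>

definition face_fan :: "real^3 \<Rightarrow> (real^3) set" where
  "face_fan v =
    (let p1 = plus_vertex v (vector [1,1,1]); p2 = plus_vertex v (vector [1,-1,-1]);
         m3 = minus_vertex v (vector [-1,1,-1]); m4 = minus_vertex v (vector [-1,-1,1])
     in if v$2 * v$3 \<le> 0
        then convex hull {0, p1, p2, m3} \<union> convex hull {0, p1, p2, m4} \<union> convex hull {0, m3, m4, m4}
        else convex hull {0, m3, m4, p1} \<union> convex hull {0, m3, m4, p2} \<union> convex hull {0, p1, p2, p2})"

lemma measure_Un_three_hulls_le:
  fixes A B C :: "(real^3) set"
  assumes "finite A" "finite B" "finite C"
  shows "measure lebesgue (convex hull A \<union> convex hull B \<union> convex hull C)
    \<le> measure lebesgue (convex hull A) + measure lebesgue (convex hull B) + measure lebesgue (convex hull C)"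
  using assms measure_Un_le[of "convex hull A \<union> convex hull B" lebesgue "convex hull C"]
    measure_Un_le[of "convex hull A" lebesgue "convex hull B"]
  by (fastforce dest!: lmeasurable_hull_finite)

text \<open>The two tetrahedra of a face have volumes \<open>\<bar>x\<bar> / 6\<close> and \<open>\<bar>y\<bar> / 6\<close> where \<open>x + y\<close> and \<open>x - y\<close> are, up to sign, the two
polynomials below (for the other fold, with \<open>-q\<close> for \<open>q\<close>). Since \<open>\<bar>x\<bar> + \<bar>y\<bar>\<close> is the larger of \<open>\<bar>x + y\<bar>\<close> and
\<open>\<bar>x - y\<bar>\<close>, the total volume is bounded whatever the orientations are. These are Cauchy-Schwarz bounds for
\<open>(c - d) \<bullet> R (c \<mp> d)\<close>, multiplied by \<open>1 + \<bar>v\<bar>\<^sup>2\<close>.\<close>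

lemma face_volume_bounds:
  fixes p q r :: real
  shows "\<bar>8 * (1 - p\<^sup>2 - 2 * q * r)\<bar> \<le> 8 * (1 + (p\<^sup>2 + q\<^sup>2 + r\<^sup>2))"
    and "\<bar>8 * (p * (q - r) + (q + r))\<bar> \<le> 8 * (1 + (p\<^sup>2 + q\<^sup>2 + r\<^sup>2))"
proof -
  have a: "0 \<le> (q + r)\<^sup>2" "0 \<le> (q - r)\<^sup>2" by simp_all
  show "\<bar>8 * (1 - p\<^sup>2 - 2 * q * r)\<bar> \<le> 8 * (1 + (p\<^sup>2 + q\<^sup>2 + r\<^sup>2))"
  proof -
    have "8 * (1 + (p\<^sup>2 + q\<^sup>2 + r\<^sup>2)) - 8 * (1 - p\<^sup>2 - 2 * q * r) = 16 * p\<^sup>2 + 8 * (q + r)\<^sup>2"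
      "8 * (1 + (p\<^sup>2 + q\<^sup>2 + r\<^sup>2)) + 8 * (1 - p\<^sup>2 - 2 * q * r) = 16 + 8 * (q - r)\<^sup>2"
      by (simp_all add: power2_eq_square algebra_simps)
    then show ?thesis using a zero_le_power2[of p] unfolding abs_le_iff by linarith
  qed
  have b: "0 \<le> (p - (q - r))\<^sup>2" "0 \<le> (p + (q - r))\<^sup>2" "0 \<le> (1 - (q + r))\<^sup>2" "0 \<le> (1 + (q + r))\<^sup>2" by simp_all
  show "\<bar>8 * (p * (q - r) + (q + r))\<bar> \<le> 8 * (1 + (p\<^sup>2 + q\<^sup>2 + r\<^sup>2))"
  proof -
    have "8 * (1 + (p\<^sup>2 + q\<^sup>2 + r\<^sup>2)) - 8 * (p * (q - r) + (q + r))
        = 4 + 4 * p\<^sup>2 + 4 * (p - (q - r))\<^sup>2 + 4 * (1 - (q + r))\<^sup>2"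
      "8 * (1 + (p\<^sup>2 + q\<^sup>2 + r\<^sup>2)) + 8 * (p * (q - r) + (q + r))
        = 4 + 4 * p\<^sup>2 + 4 * (p + (q - r))\<^sup>2 + 4 * (1 + (q + r))\<^sup>2"
      by (simp_all add: power2_eq_square algebra_simps)
    then show ?thesis using b zero_le_power2[of p] unfolding abs_le_iff by linarith
  qed
qed

lemma measure_face_fan:
  "measure lebesgue (face_fan v) \<le> 8 * (1 + v \<bullet> v) / 6"
proof -
  define p q r where "p = v$1" and "q = v$2" and "r = v$3"
  define p1 p2 m3 m4 where "p1 = plus_vertex v (vector [1,1,1])" and "p2 = plus_vertex v (vector [1,-1,-1])"
    and "m3 = minus_vertex v (vector [-1,1,-1])" and "m4 = minus_vertex v (vector [-1,-1,1])"
  note defs = p1_def p2_def m3_def m4_def plus_vertex_def minus_vertex_def p_def q_def r_def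
  have vv: "v \<bullet> v = p\<^sup>2 + q\<^sup>2 + r\<^sup>2"
    by (simp add: inner_vec_def sum_3 p_def q_def r_def power2_eq_square)
  have d: "p1 \<bullet> cross3 p2 m3 = - (4 * (1 - p\<^sup>2 - 2 * q * r)) + 4 * (p * (q - r) + (q + r))"
    "p1 \<bullet> cross3 p2 m4 = 4 * (1 - p\<^sup>2 - 2 * q * r) + 4 * (p * (q - r) + (q + r))"
    "m3 \<bullet> cross3 m4 p1 = 4 * (1 - p\<^sup>2 - 2 * (- q) * r) - 4 * (p * (- q - r) + (- q + r))"
    "m3 \<bullet> cross3 m4 p2 = - (4 * (1 - p\<^sup>2 - 2 * (- q) * r)) - 4 * (p * (- q - r) + (- q + r))"
    "p1 \<bullet> cross3 p2 p2 = 0" "m3 \<bullet> cross3 m4 m4 = 0"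
    by (simp_all add: defs cross3_simps power2_eq_square)
  have b: "\<bar>x\<bar> / 6 + \<bar>y\<bar> / 6 \<le> 8 * (1 + v \<bullet> v) / 6"
    if "\<bar>x + y\<bar> \<le> 8 * (1 + v \<bullet> v)" "\<bar>x - y\<bar> \<le> 8 * (1 + v \<bullet> v)" for x y :: real
    using that by (simp add: abs_if split: if_splits)
  show ?thesis
  proof (cases "v$2 * v$3 \<le> 0")
    case True
    then have "measure lebesgue (face_fan v) \<le> \<bar>p1 \<bullet> cross3 p2 m3\<bar> / 6 + \<bar>p1 \<bullet> cross3 p2 m4\<bar> / 6"
      using measure_Un_three_hulls_le[of "{0, p1, p2, m3}" "{0, p1, p2, m4}" "{0, m3, m4, m4}"]
      unfolding face_fan_def Let_def p1_def[symmetric] p2_def[symmetric] m3_def[symmetric] m4_def[symmetric]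
        measure_tetrahedron_zero by (simp add: d(6))
    also have "\<dots> \<le> 8 * (1 + v \<bullet> v) / 6"
      by (rule b) (use face_volume_bounds[of p q r] d vv in \<open>simp_all add: algebra_simps abs_minus_commute\<close>)
    finally show ?thesis .
  next
    case False
    then have "measure lebesgue (face_fan v) \<le> \<bar>m3 \<bullet> cross3 m4 p1\<bar> / 6 + \<bar>m3 \<bullet> cross3 m4 p2\<bar> / 6"
      using measure_Un_three_hulls_le[of "{0, m3, m4, p1}" "{0, m3, m4, p2}" "{0, p1, p2, p2}"]
      unfolding face_fan_def Let_def p1_def[symmetric] p2_def[symmetric] m3_def[symmetric] m4_def[symmetric]
        measure_tetrahedron_zero by (simp add: d(5))
    also have "\<dots> \<le> 8 * (1 + v \<bullet> v) / 6"
      by (rule b) (use face_volume_bounds[of p "-q" r] d vv in \<open>simp_all add: algebra_simps abs_minus_commute\<close>)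
    finally show ?thesis .
  qed
qed

section \<open>The cone over one face\<close>

lemma contact_coords:
  fixes v k :: "real^3"
  defines "z \<equiv> cross3 v k"
  shows "z$1 = v$2 * k$3 - v$3 * k$2" "z$2 = v$3 * k$1 - v$1 * k$3" "z$3 = v$1 * k$2 - v$2 * k$1"
    "k \<bullet> plus_vertex v (vector [1,1,1]) = z$1 + z$2 + z$3 + (k$1 + k$2 + k$3)"
    "k \<bullet> plus_vertex v (vector [1,-1,-1]) = z$1 - z$2 - z$3 + (k$1 - k$2 - k$3)"
    "k \<bullet> plus_vertex v (vector [-1,1,-1]) = - z$1 + z$2 - z$3 + (- k$1 + k$2 - k$3)"
    "k \<bullet> plus_vertex v (vector [-1,-1,1]) = - z$1 - z$2 + z$3 + (- k$1 - k$2 + k$3)"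
    "k \<bullet> minus_vertex v (vector [1,1,1]) = z$1 + z$2 + z$3 - (k$1 + k$2 + k$3)"
    "k \<bullet> minus_vertex v (vector [1,-1,-1]) = z$1 - z$2 - z$3 - (k$1 - k$2 - k$3)"
    "k \<bullet> minus_vertex v (vector [-1,1,-1]) = - z$1 + z$2 - z$3 - (- k$1 + k$2 - k$3)"
    "k \<bullet> minus_vertex v (vector [-1,-1,1]) = - z$1 - z$2 + z$3 - (- k$1 - k$2 + k$3)"
  by (simp_all add: z_def cross_components inner_plus_vertex inner_minus_vertex inner_sign_vector)

text \<open>The four triples of vertices of the face: two on either side of each diagonal. The symmetries of the face turn each of them
into the triple of \<open>diagonal_contact_coords\<close>, some of them with the sign of \<open>v$2 * v$3\<close> reversed.\<close>

lemma diagonal_contacts: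
  assumes l: "l1_norm v < 1" and S: "supports v k"
  defines "p1 \<equiv> k \<bullet> plus_vertex v (vector [1,1,1])" and "p2 \<equiv> k \<bullet> plus_vertex v (vector [1,-1,-1])"
    and "m3 \<equiv> k \<bullet> minus_vertex v (vector [-1,1,-1])" and "m4 \<equiv> k \<bullet> minus_vertex v (vector [-1,-1,1])"
  shows "p1 = 1 \<Longrightarrow> p2 = 1 \<Longrightarrow> m3 = 1 \<Longrightarrow> v$2 * v$3 < 0 \<or> v$2 * v$3 = 0 \<and> m4 = 1"
    and "p1 = 1 \<Longrightarrow> p2 = 1 \<Longrightarrow> m4 = 1 \<Longrightarrow> v$2 * v$3 < 0 \<or> v$2 * v$3 = 0 \<and> m3 = 1"
    and "m3 = 1 \<Longrightarrow> m4 = 1 \<Longrightarrow> p1 = 1 \<Longrightarrow> v$2 * v$3 > 0 \<or> v$2 * v$3 = 0 \<and> p2 = 1"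
    and "m3 = 1 \<Longrightarrow> m4 = 1 \<Longrightarrow> p2 = 1 \<Longrightarrow> v$2 * v$3 > 0 \<or> v$2 * v$3 = 0 \<and> p1 = 1"
proof -
  define z where "z = cross3 v k"
  note zs = contact_coords[where v = v and k = k, folded z_def]
  have l: "\<bar>v$1\<bar> + \<bar>v$2\<bar> + \<bar>v$3\<bar> < 1" using l by (simp add: l1_norm_def)
  have le: "k \<bullet> plus_vertex v a \<le> 1" "k \<bullet> minus_vertex v a \<le> 1" if "a \<in> std_tet" for a
    using S that by (auto simp: supports_def)
  have ne: "k \<bullet> plus_vertex v a = 1 \<Longrightarrow> k \<bullet> minus_vertex v a < 1" "k \<bullet> minus_vertex v a = 1 \<Longrightarrow> k \<bullet> plus_vertex v a < 1" if "a \<in> std_tet" for a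
    using contacts_disjoint[OF assms(1) S] le[OF that] that by (fastforce simp: plus_contacts_def minus_contacts_def)+
  have t: "vector [1,1,1] \<in> std_tet" "vector [1,-1,-1] \<in> std_tet" "vector [-1,1,-1] \<in> std_tet" "vector [-1,-1,1] \<in> std_tet"
    by (simp_all add: std_tet_def)
  have le': "p1 \<le> 1" "p2 \<le> 1" "m3 \<le> 1" "m4 \<le> 1" using le t by (simp_all add: p1_def p2_def m3_def m4_def)
  note U = p1_def p2_def m3_def m4_def zs(4-)
  note F = le'[unfolded U]
  show "v$2 * v$3 < 0 \<or> v$2 * v$3 = 0 \<and> m4 = 1" if h: "p1 = 1" "p2 = 1" "m3 = 1"
  proof -
    note n = ne(1)[OF t(1), folded p1_def, OF h(1)] ne(1)[OF t(2), folded p2_def, OF h(2)] ne(2)[OF t(3), folded m3_def, OF h(3)]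
    note h' = h[unfolded U] n[unfolded U]
    have "v$2 * v$3 < 0 \<or> v$2 * v$3 = 0 \<and> - z$1 - z$2 + z$3 - (- k$1 - k$2 + k$3) = 1"
      by (rule diagonal_contact_coords[of "v$1" "v$2" "v$3" "z$1" "k$3" "k$2" "z$2" "k$1" "z$3"];
          ((insert l; simp; fail) | (insert h' zs(1-3) F; linarith)))
    then show ?thesis unfolding U by argo
  qed
  show "v$2 * v$3 < 0 \<or> v$2 * v$3 = 0 \<and> m3 = 1" if h: "p1 = 1" "p2 = 1" "m4 = 1"
  proof -
    note n = ne(1)[OF t(1), folded p1_def, OF h(1)] ne(1)[OF t(2), folded p2_def, OF h(2)] ne(2)[OF t(4), folded m4_def, OF h(3)]
    note h' = h[unfolded U] n[unfolded U]
    have "(-v$2) * (-v$3) < 0 \<or> (-v$2) * (-v$3) = 0 \<and> - z$1 - (-z$2) + (-z$3) - (- k$1 - (-k$2) + (-k$3)) = 1"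
      by (rule diagonal_contact_coords[of "v$1" "-v$2" "-v$3" "z$1" "-k$3" "-k$2" "-z$2" "k$1" "-z$3"];
          ((insert l; simp; fail) | (insert h' zs(1-3) F; linarith)))
    then show ?thesis unfolding U by (simp; argo)
  qed
  show "v$2 * v$3 > 0 \<or> v$2 * v$3 = 0 \<and> p2 = 1" if h: "m3 = 1" "m4 = 1" "p1 = 1"
  proof -
    note n = ne(2)[OF t(3), folded m3_def, OF h(1)] ne(2)[OF t(4), folded m4_def, OF h(2)] ne(1)[OF t(1), folded p1_def, OF h(3)]
    note h' = h[unfolded U] n[unfolded U]
    have "(-v$2) * v$3 < 0 \<or> (-v$2) * v$3 = 0 \<and> - (-z$1) - z$2 + (-z$3) - (- k$1 - (-k$2) + k$3) = 1"
      by (rule diagonal_contact_coords[of "v$1" "-v$2" "v$3" "-z$1" "k$3" "-k$2" "z$2" "k$1" "-z$3"];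
          ((insert l; simp; fail) | (insert h' zs(1-3) F; linarith)))
    then show ?thesis unfolding U by (simp; argo)
  qed
  show "v$2 * v$3 > 0 \<or> v$2 * v$3 = 0 \<and> p1 = 1" if h: "m3 = 1" "m4 = 1" "p2 = 1"
  proof -
    note n = ne(2)[OF t(3), folded m3_def, OF h(1)] ne(2)[OF t(4), folded m4_def, OF h(2)] ne(1)[OF t(2), folded p2_def, OF h(3)]
    note h' = h[unfolded U] n[unfolded U]
    have "v$2 * (-v$3) < 0 \<or> v$2 * (-v$3) = 0 \<and> - (-z$1) - (-z$2) + z$3 - (- k$1 - k$2 + (-k$3)) = 1"
      by (rule diagonal_contact_coords[of "v$1" "v$2" "-v$3" "-z$1" "-k$3" "k$2" "-z$2" "k$1" "z$3"];
          ((insert l; simp; fail) | (insert h' zs(1-3) F; linarith)))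
    then show ?thesis unfolding U by (simp; argo)
  qed
qed

text \<open>If \<open>v$2 * v$3 \<noteq> 0\<close>, the contacts miss a vertex of every forbidden triple, so they span one of the three hulls of the fan. If
the product is \<open>0\<close>, all four vertices may touch, and the plane face is cut along its diagonal.\<close>

lemma face_contacts_subset_fan:
  assumes l: "l1_norm v < 1" and S: "supports v k"
    and P: "plus_contacts v k \<subseteq> {vector [1,1,1], vector [1,-1,-1]}"
    and M: "minus_contacts v k \<subseteq> {vector [-1,1,-1], vector [-1,-1,1]}"
  shows "convex hull (insert 0 (plus_vertex v ` plus_contacts v k \<union> minus_vertex v ` minus_contacts v k)) \<subseteq> face_fan v"
proof -
  define p1 p2 m3 m4 where "p1 = plus_vertex v (vector [1,1,1])" and "p2 = plus_vertex v (vector [1,-1,-1])"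
    and "m3 = minus_vertex v (vector [-1,1,-1])" and "m4 = minus_vertex v (vector [-1,-1,1])"
  note defs = p1_def p2_def m3_def m4_def
  note D = diagonal_contacts[OF l S, folded defs]
  let ?C = "plus_vertex v ` plus_contacts v k \<union> minus_vertex v ` minus_contacts v k"
  have C1: "x \<in> {p1, p2, m3, m4}" if "x \<in> ?C" for x using that P M defs by auto
  have C2: "k \<bullet> x = 1" if "x \<in> ?C" for x using that by (auto simp: plus_contacts_def minus_contacts_def)
  have C: "insert 0 ?C \<subseteq> insert 0 {x \<in> {p1, p2, m3, m4}. k \<bullet> x = 1}" using C1 C2 by blast
  have F: "face_fan v = (if v$2 * v$3 \<le> 0
        then convex hull {0, p1, p2, m3} \<union> convex hull {0, p1, p2, m4} \<union> convex hull {0, m3, m4, m4}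
        else convex hull {0, m3, m4, p1} \<union> convex hull {0, m3, m4, p2} \<union> convex hull {0, p1, p2, p2})"
    by (simp add: face_fan_def Let_def defs)
  have mono: "convex hull (insert 0 ?C) \<subseteq> convex hull T" if "insert 0 {x \<in> {p1, p2, m3, m4}. k \<bullet> x = 1} \<subseteq> T" for T
    using C that by (intro hull_mono) blast
  show ?thesis
  proof (cases "v$2 * v$3 \<le> 0")
    case True
    then have F: "face_fan v = convex hull {0, p1, p2, m3} \<union> convex hull {0, p1, p2, m4} \<union> convex hull {0, m3, m4, m4}"
      using F by simp
    consider "k \<bullet> m4 \<noteq> 1" | "k \<bullet> m3 \<noteq> 1" | "k \<bullet> p1 \<noteq> 1" "k \<bullet> p2 \<noteq> 1"
      | "v$2 * v$3 = 0"
      using D(3,4) True by linarith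
    then show ?thesis
    proof cases
      case 1
      then have "convex hull (insert 0 ?C) \<subseteq> convex hull {0, p1, p2, m3}" by (intro mono) auto
      then show ?thesis using F by blast
    next
      case 2
      then have "convex hull (insert 0 ?C) \<subseteq> convex hull {0, p1, p2, m4}" by (intro mono) auto
      then show ?thesis using F by blast
    next
      case 3
      then have "convex hull (insert 0 ?C) \<subseteq> convex hull {0, m3, m4, m4}" by (intro mono) auto
      then show ?thesis using F by blast
    next
      case 4
      define p q r where "p = v$1" and "q = v$2" and "r = v$3"
      have qr: "q * r = 0" using 4 by (simp add: q_def r_def)
      have l': "\<bar>p\<bar> + \<bar>q\<bar> + \<bar>r\<bar> < 1" using l by (simp add: l1_norm_def p_def q_def r_def)
      \<comment> \<open>Up to a common factor, the determinants of the four triples of vertices: coefficients of the linear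
        relation between the vertices of the face. They are positive because \<open>v\<close> is inside the octahedron.\<close>
      define s t u w where "s = (1 - p - q) * (1 + p + r)" and "t = (1 - p + q) * (1 + p - r)"
        and "u = (1 - p + q) * (1 + p + r)" and "w = (1 - p - q) * (1 + p - r)"
      have pos: "0 < s" "0 < t" "0 < u" "0 < w"
        unfolding s_def t_def u_def w_def by (rule mult_pos_pos; use l' in linarith)+
      have sum: "s + t = u + w"
        using qr unfolding s_def t_def u_def w_def by (simp add: algebra_simps)
      have rel: "s *\<^sub>R p1 + t *\<^sub>R p2 = u *\<^sub>R m3 + w *\<^sub>R m4"
        using qr
        by (auto simp: vec_eq_iff forall_3 defs plus_vertex_def minus_vertex_def cross_components s_def t_def u_def w_def
              p_def[symmetric] q_def[symmetric] r_def[symmetric] algebra_simps)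
      have "convex hull (insert 0 ?C) \<subseteq> convex hull {0, p1, p2, m3, m4}" by (intro mono) auto
      then show ?thesis using F quadrilateral_split[OF pos sum rel] by blast
    qed
  next
    case False
    then have F: "face_fan v = convex hull {0, m3, m4, p1} \<union> convex hull {0, m3, m4, p2} \<union> convex hull {0, p1, p2, p2}"
      using F by simp
    consider "k \<bullet> p1 \<noteq> 1" | "k \<bullet> p2 \<noteq> 1" | "k \<bullet> m3 \<noteq> 1" "k \<bullet> m4 \<noteq> 1"
      using D(1,2) False by linarith
    then show ?thesis
    proof cases
      case 1
      then have "convex hull (insert 0 ?C) \<subseteq> convex hull {0, m3, m4, p2}" by (intro mono) auto
      then show ?thesis using F by blast
    next
      case 2
      then have "convex hull (insert 0 ?C) \<subseteq> convex hull {0, m3, m4, p1}" by (intro mono) auto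
      then show ?thesis using F by blast
    next
      case 3
      then have "convex hull (insert 0 ?C) \<subseteq> convex hull {0, p1, p2, p2}" by (intro mono) auto
      then show ?thesis using F by blast
    qed
  qed
qed

section \<open>Rotating every face to the first one\<close>

definition tet_symmetry :: "(real^3 \<Rightarrow> real^3) \<Rightarrow> bool" where
  "tet_symmetry g \<longleftrightarrow> orthogonal_transformation g \<and> (\<forall>x y. g (cross3 x y) = cross3 (g x) (g y))
     \<and> g ` std_tet = std_tet \<and> (\<forall>x. l1_norm (g x) = l1_norm x)"

definition cyc :: "real^3 \<Rightarrow> real^3" where "cyc x = vector [x$2, x$3, x$1]"
definition flip_xz :: "real^3 \<Rightarrow> real^3" where "flip_xz x = vector [- x$1, x$2, - x$3]"

lemma tet_symmetry_compose: "tet_symmetry f \<Longrightarrow> tet_symmetry g \<Longrightarrow> tet_symmetry (f \<circ> g)"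
  by (simp add: tet_symmetry_def orthogonal_transformation_compose flip: image_image)

lemma cyc_vector: "cyc (vector [x, y, z]) = vector [y, z, x]"
  and flip_xz_vector: "flip_xz (vector [x, y, z]) = vector [-x, y, -z]"
  by (simp_all add: cyc_def flip_xz_def)

lemma tet_symmetry_cyc: "tet_symmetry cyc"
  unfolding tet_symmetry_def
proof (intro conjI allI)
  show "orthogonal_transformation cyc"
    unfolding orthogonal_transformation_def
    by (auto simp: linear_iff cyc_def vec_eq_iff forall_3 inner_vec_def sum_3)
  show "cyc ` std_tet = std_tet" by (auto simp: std_tet_def cyc_vector)
qed (simp_all add: cyc_def cross3_def vec_eq_iff forall_3 l1_norm_def)

lemma tet_symmetry_flip_xz: "tet_symmetry flip_xz"
  unfolding tet_symmetry_def
proof (intro conjI allI)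
  show "orthogonal_transformation flip_xz"
    unfolding orthogonal_transformation_def
    by (auto simp: linear_iff flip_xz_def vec_eq_iff forall_3 inner_vec_def sum_3)
  show "flip_xz ` std_tet = std_tet" by (auto simp: std_tet_def flip_xz_vector)
qed (simp_all add: flip_xz_def cross3_def vec_eq_iff forall_3 l1_norm_def)

text \<open>One rotation for each face of the cube, carrying it to the face in direction \<open>(1, 0, 0)\<close>.\<close>

definition face_rotations :: "(real^3 \<Rightarrow> real^3) set" where
  "face_rotations = {id, cyc, cyc \<circ> cyc, flip_xz, flip_xz \<circ> cyc, flip_xz \<circ> (cyc \<circ> cyc)}"

lemma face_rotations_symmetry: "g \<in> face_rotations \<Longrightarrow> tet_symmetry g"
proof -
  have "tet_symmetry id" by (simp add: tet_symmetry_def orthogonal_transformation_def linear_id)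
  then show "g \<in> face_rotations \<Longrightarrow> tet_symmetry g"
    unfolding face_rotations_def
    using tet_symmetry_cyc tet_symmetry_flip_xz tet_symmetry_compose by blast
qed

lemma symmetry_transports:
  assumes "tet_symmetry g"
  shows "g (plus_vertex v a) = plus_vertex (g v) (g a)" "g (minus_vertex v a) = minus_vertex (g v) (g a)"
    "supports (g v) (g k) = supports v k"
    "plus_contacts (g v) (g k) = g ` plus_contacts v k" "minus_contacts (g v) (g k) = g ` minus_contacts v k"
proof -
  have lin: "linear g" and o: "\<And>x y. g x \<bullet> g y = x \<bullet> y"
    using assms by (auto simp: tet_symmetry_def orthogonal_transformation_def)
  have c: "\<And>x y. g (cross3 x y) = cross3 (g x) (g y)" and t: "g ` std_tet = std_tet"
    using assms by (auto simp: tet_symmetry_def)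
  show p: "g (plus_vertex v a) = plus_vertex (g v) (g a)" and m: "g (minus_vertex v a) = minus_vertex (g v) (g a)" for a
    by (simp_all add: plus_vertex_def minus_vertex_def linear_add[OF lin] linear_diff[OF lin] c)
  have pi: "g k \<bullet> plus_vertex (g v) (g a) = k \<bullet> plus_vertex v a" "g k \<bullet> minus_vertex (g v) (g a) = k \<bullet> minus_vertex v a" for a
    by (simp_all add: p[symmetric] m[symmetric] o)
  show "supports (g v) (g k) = supports v k"
    unfolding supports_def by (subst t[symmetric]) (simp add: pi)
  show "plus_contacts (g v) (g k) = g ` plus_contacts v k"
    unfolding plus_contacts_def by (subst t[symmetric]) (auto simp: pi)
  show "minus_contacts (g v) (g k) = g ` minus_contacts v k"
    unfolding minus_contacts_def by (subst t[symmetric]) (auto simp: pi)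
qed

text \<open>Disjoint label sets with at most two elements each extend to a splitting of \<open>std_tet\<close> into two pairs, and each of the
six ordered splittings belongs to one face.\<close>

lemma contacts_rotate_to_face:
  assumes l: "l1_norm v < 1" and S: "supports v k"
  obtains g where "g \<in> face_rotations"
    "g ` plus_contacts v k \<subseteq> {vector [1,1,1], vector [1,-1,-1]}"
    "g ` minus_contacts v k \<subseteq> {vector [-1,1,-1], vector [-1,-1,1]}"
proof -
  define a1 a2 a3 a4 :: "real^3" where "a1 = vector [1,1,1]" and "a2 = vector [1,-1,-1]"
    and "a3 = vector [-1,1,-1]" and "a4 = vector [-1,-1,1]"
  note defs = a1_def a2_def a3_def a4_def
  have T: "std_tet = {a1, a2, a3, a4}" by (simp add: std_tet_def defs)
  have d: "a1 \<noteq> a2" "a1 \<noteq> a3" "a1 \<noteq> a4" "a2 \<noteq> a3" "a2 \<noteq> a4" "a3 \<noteq> a4"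
    by (simp_all add: defs vector3_eq_iff)
  have cy: "cyc a1 = a1" "cyc a2 = a4" "cyc a3 = a2" "cyc a4 = a3"
    by (simp_all add: defs cyc_vector)
  have fl: "flip_xz a1 = a3" "flip_xz a3 = a1" "flip_xz a2 = a4" "flip_xz a4 = a2"
    by (simp_all add: defs flip_xz_vector)
  let ?P = "plus_contacts v k" and ?M = "minus_contacts v k"
  have sub: "?P \<subseteq> std_tet" "?M \<subseteq> std_tet" by (auto simp: plus_contacts_def minus_contacts_def)
  have dis: "?P \<inter> ?M = {}" by (rule contacts_disjoint[OF l S])
  have dis': "\<not> (a1 \<in> ?P \<and> a1 \<in> ?M)" "\<not> (a2 \<in> ?P \<and> a2 \<in> ?M)" "\<not> (a3 \<in> ?P \<and> a3 \<in> ?M)" "\<not> (a4 \<in> ?P \<and> a4 \<in> ?M)"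
    using dis by blast+
  have three: "\<not> std_tet - {a} \<subseteq> ?P" "\<not> std_tet - {a} \<subseteq> ?M" if "a \<in> std_tet" for a
    using plus_contacts_not_facet[OF l S that] minus_contacts_not_facet[OF l S that] by auto
  have in_pair: "X \<subseteq> {a1, a2} \<longleftrightarrow> a3 \<notin> X \<and> a4 \<notin> X" "X \<subseteq> {a3, a4} \<longleftrightarrow> a1 \<notin> X \<and> a2 \<notin> X"
    "X \<subseteq> {a1, a3} \<longleftrightarrow> a2 \<notin> X \<and> a4 \<notin> X" "X \<subseteq> {a2, a4} \<longleftrightarrow> a1 \<notin> X \<and> a3 \<notin> X"
    "X \<subseteq> {a1, a4} \<longleftrightarrow> a2 \<notin> X \<and> a3 \<notin> X" "X \<subseteq> {a2, a3} \<longleftrightarrow> a1 \<notin> X \<and> a4 \<notin> X"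
    if "X \<subseteq> std_tet" for X
    using that d unfolding T by blast+
  have "\<not> (a2 \<in> X \<and> a3 \<in> X \<and> a4 \<in> X)" "\<not> (a1 \<in> X \<and> a3 \<in> X \<and> a4 \<in> X)"
    "\<not> (a1 \<in> X \<and> a2 \<in> X \<and> a4 \<in> X)" "\<not> (a1 \<in> X \<and> a2 \<in> X \<and> a3 \<in> X)"
    if "X \<in> {?P, ?M}" for X
    using that three unfolding T by blast+
  from this[OF insertI1] this[OF insertI2[OF singletonI]]
  have "(?P \<subseteq> {a1, a2} \<and> ?M \<subseteq> {a3, a4}) \<or> (?P \<subseteq> {a3, a4} \<and> ?M \<subseteq> {a1, a2})
    \<or> (?P \<subseteq> {a1, a3} \<and> ?M \<subseteq> {a2, a4}) \<or> (?P \<subseteq> {a2, a4} \<and> ?M \<subseteq> {a1, a3})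
    \<or> (?P \<subseteq> {a1, a4} \<and> ?M \<subseteq> {a2, a3}) \<or> (?P \<subseteq> {a2, a3} \<and> ?M \<subseteq> {a1, a4})"
    using dis' unfolding in_pair[OF sub(1)] in_pair[OF sub(2)] by argo
  then have "\<exists>g\<in>face_rotations. g ` ?P \<subseteq> {a1, a2} \<and> g ` ?M \<subseteq> {a3, a4}"
  proof (elim disjE conjE)
    assume "?P \<subseteq> {a1, a2}" "?M \<subseteq> {a3, a4}"
    then show ?thesis by (intro bexI[of _ id]) (auto simp: face_rotations_def)
  next
    assume "?P \<subseteq> {a3, a4}" "?M \<subseteq> {a1, a2}"
    then show ?thesis using fl by (intro bexI[of _ flip_xz]) (auto simp: face_rotations_def)
  next
    assume "?P \<subseteq> {a1, a3}" "?M \<subseteq> {a2, a4}"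
    then show ?thesis using cy by (intro bexI[of _ cyc]) (auto simp: face_rotations_def)
  next
    assume "?P \<subseteq> {a2, a4}" "?M \<subseteq> {a1, a3}"
    then show ?thesis using cy fl by (intro bexI[of _ "flip_xz \<circ> cyc"]) (auto simp: face_rotations_def)
  next
    assume "?P \<subseteq> {a1, a4}" "?M \<subseteq> {a2, a3}"
    then show ?thesis using cy by (intro bexI[of _ "cyc \<circ> cyc"]) (auto simp: face_rotations_def)
  next
    assume "?P \<subseteq> {a2, a3}" "?M \<subseteq> {a1, a4}"
    then show ?thesis using cy fl by (intro bexI[of _ "flip_xz \<circ> (cyc \<circ> cyc)"]) (auto simp: face_rotations_def)
  qed
  then show ?thesis using that unfolding defs by blast
qed

section \<open>Covering a polytope by cones over contact sets\<close>

text \<open>In a convex combination attaining the maximum of \<open>k\<close>, points below the maximum have weight zero.\<close>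

lemma convex_hull_contact_points:
  fixes S :: "'a::euclidean_space set"
  assumes "finite S" and le: "\<And>s. s \<in> S \<Longrightarrow> k \<bullet> s \<le> 1" and y: "y \<in> convex hull S" "k \<bullet> y = 1"
  shows "y \<in> convex hull {s \<in> S. k \<bullet> s = 1}"
proof -
  obtain u where u: "\<And>s. s \<in> S \<Longrightarrow> 0 \<le> u s" "sum u S = 1" "(\<Sum>s\<in>S. u s *\<^sub>R s) = y"
    using y(1) unfolding convex_hull_finite[OF assms(1)] by blast
  have "(\<Sum>s\<in>S. u s * (1 - k \<bullet> s)) = sum u S - k \<bullet> (\<Sum>s\<in>S. u s *\<^sub>R s)"
    by (simp add: inner_sum_right algebra_simps sum_subtractf)
  also have "\<dots> = 0" using u(2,3) y(2) by simp
  finally have "\<forall>s\<in>S. u s * (1 - k \<bullet> s) = 0"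
    by (subst sum_nonneg_eq_0_iff[symmetric]) (use assms(1) u(1) le in auto)
  then have z: "u s = 0" if "s \<in> S - {s \<in> S. k \<bullet> s = 1}" for s using that by auto
  let ?C = "{s \<in> S. k \<bullet> s = 1}"
  have "sum u ?C = sum u S" "(\<Sum>s\<in>?C. u s *\<^sub>R s) = (\<Sum>s\<in>S. u s *\<^sub>R s)"
    using z by (intro sum.mono_neutral_left[OF assms(1)]; simp)+
  then have "\<exists>u. (\<forall>s\<in>?C. 0 \<le> u s) \<and> sum u ?C = 1 \<and> (\<Sum>s\<in>?C. u s *\<^sub>R s) = y"
    using u by (intro exI[of _ u]) auto
  moreover have "finite ?C" using assms(1) by simp
  ultimately show ?thesis by (simp add: convex_hull_finite)
qed

text \<open>Prolong the ray from the origin through \<open>x\<close> to the frontier and take a supporting hyperplane there, normalised to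
\<open>k \<bullet> y = 1\<close>.\<close>

lemma convex_hull_covered_by_contact_cones:
  fixes S :: "'a::euclidean_space set"
  assumes fin: "finite S" and int: "0 \<in> interior (convex hull S)" and x: "x \<in> convex hull S"
  obtains k where "\<And>s. s \<in> S \<Longrightarrow> k \<bullet> s \<le> 1" "x \<in> convex hull (insert 0 {s \<in> S. k \<bullet> s = 1})"
proof (cases "x = 0")
  case True
  show ?thesis by (rule that[of 0]) (simp_all add: True hull_inc)
next
  case False
  let ?K = "convex hull S"
  have K: "compact ?K" "convex ?K" using fin by (simp_all add: finite_imp_compact_convex_hull)
  obtain d where d: "0 < d" "d *\<^sub>R x \<in> frontier ?K" "\<And>e. 0 \<le> e \<Longrightarrow> e < d \<Longrightarrow> e *\<^sub>R x \<in> interior ?K"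
    using ray_to_frontier[OF compact_imp_bounded[OF K(1)] int False] by auto
  have "1 \<le> d"
  proof (rule ccontr)
    assume "\<not> 1 \<le> d"
    then have "x - (1 - d) *\<^sub>R (x - 0) \<in> interior ?K"
      using d(1) by (intro mem_interior_convex_shrink[OF K(2) int x]) auto
    then have "d *\<^sub>R x \<in> interior ?K" by (simp add: algebra_simps)
    then show False using d(2) by (simp add: frontier_def)
  qed
  let ?y = "d *\<^sub>R x"
  have yK: "?y \<in> ?K" using d(2) K(1) by (simp add: frontier_def compact_imp_closed)
  have ri: "rel_interior ?K = interior ?K" using int by (intro rel_interior_nonempty_interior) auto
  have nri: "?y \<notin> rel_interior ?K" using d(2) ri by (simp add: frontier_def)
  obtain a where "a \<noteq> 0" and a: "\<And>z. z \<in> ?K \<Longrightarrow> a \<bullet> ?y \<le> a \<bullet> z" "\<And>z. z \<in> rel_interior ?K \<Longrightarrow> a \<bullet> ?y < a \<bullet> z"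
    by (rule supporting_hyperplane_rel_boundary[OF K(2) yK nri]) (metis that)
  have neg: "a \<bullet> ?y < 0" using a(2)[of 0] int ri by simp
  define k where "k = (1 / (a \<bullet> ?y)) *\<^sub>R a"
  have kle: "k \<bullet> z \<le> 1" if "z \<in> ?K" for z
    using a(1)[OF that] neg by (simp add: k_def divide_le_eq)
  have ky: "k \<bullet> ?y = 1" using neg by (auto simp: k_def)
  have "?y \<in> convex hull {s \<in> S. k \<bullet> s = 1}"
    by (rule convex_hull_contact_points[OF fin kle[OF hull_inc] yK ky])
  then have "?y \<in> convex hull (insert 0 {s \<in> S. k \<bullet> s = 1})" (is "_ \<in> ?H")
    using hull_mono[of "{s \<in> S. k \<bullet> s = 1}" "insert 0 {s \<in> S. k \<bullet> s = 1}" convex] by blast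
  moreover have "0 \<in> ?H" by (simp add: hull_inc)
  ultimately have "(1 - 1 / d) *\<^sub>R 0 + (1 / d) *\<^sub>R ?y \<in> ?H"
    using \<open>1 \<le> d\<close> by (intro convexD[OF convex_convex_hull]) auto
  then have xH: "x \<in> ?H" using d(1) by simp
  show ?thesis by (rule that[OF kle[OF hull_inc] xH])
qed

section \<open>The volume of the sheared hull\<close>

definition twin_hull :: "real^3 \<Rightarrow> (real^3) set" where
  "twin_hull v = convex hull (plus_vertex v ` std_tet \<union> minus_vertex v ` std_tet)"

lemma affine_independent_std_tet: "\<not> affine_dependent std_tet" and card_std_tet: "card std_tet = 4"
proof -
  show "card std_tet = 4" by (simp add: std_tet_def vector3_eq_iff)
  show "\<not> affine_dependent std_tet"
  proof
    have f: "finite std_tet" by (simp add: std_tet_def)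
    assume "affine_dependent std_tet"
    then obtain U where U: "sum U std_tet = 0" "\<exists>v\<in>std_tet. U v \<noteq> 0" "(\<Sum>v\<in>std_tet. U v *\<^sub>R v) = 0"
      unfolding affine_dependent_explicit_finite[OF f] by blast
    show False
      using U by (simp add: std_tet_def vector3_eq_iff vec_eq_iff forall_3)
  qed
qed

lemma linear_plus_vertex: "linear (plus_vertex v)"
  by (rule linearI) (simp_all add: plus_vertex_def cross_add_left cross_mult_left algebra_simps)

lemma det_plus_vertex: "det (matrix (plus_vertex v)) = 1 + v \<bullet> v"
  by (simp add: det_3 matrix_def plus_vertex_def axis_def cross3_simps power2_eq_square)

lemma inj_plus_vertex: "inj (plus_vertex v)"
proof -
  have "det (matrix (plus_vertex v)) \<noteq> 0" unfolding det_plus_vertex using inner_ge_zero[of v] by linarith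
  then show ?thesis using det_nz_iff_inj[OF linear_plus_vertex] by blast
qed

lemma zero_in_interior_std_tet: "0 \<in> interior (convex hull std_tet)"
  unfolding interior_convex_hull_explicit_minimal[OF affine_independent_std_tet]
  by (auto simp: card_std_tet intro!: exI[of _ "\<lambda>_. 1/4"]) (simp add: std_tet_def vector3_eq_iff vec_eq_iff forall_3)

lemma zero_in_interior_twin_hull: "0 \<in> interior (twin_hull v)"
proof -
  have "plus_vertex v 0 \<in> plus_vertex v ` interior (convex hull std_tet)" using zero_in_interior_std_tet by blast
  also have "\<dots> = interior (convex hull (plus_vertex v ` std_tet))"
    by (simp add: interior_injective_linear_image[OF linear_plus_vertex inj_plus_vertex, symmetric] convex_hull_linear_image[OF linear_plus_vertex])
  also have "\<dots> \<subseteq> interior (twin_hull v)"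
    unfolding twin_hull_def by (intro interior_mono hull_mono) auto
  finally show ?thesis by (simp add: linear_0[OF linear_plus_vertex])
qed

lemma twin_hull_covered_by_fans:
  assumes l: "l1_norm v < 1"
  shows "twin_hull v \<subseteq> (\<Union>g\<in>face_rotations. g -` face_fan (g v))"
proof
  fix x assume x: "x \<in> twin_hull v"
  have fin: "finite (plus_vertex v ` std_tet \<union> minus_vertex v ` std_tet)" by (simp add: std_tet_def)
  obtain k where k: "\<And>s. s \<in> plus_vertex v ` std_tet \<union> minus_vertex v ` std_tet \<Longrightarrow> k \<bullet> s \<le> 1"
    and xk: "x \<in> convex hull (insert 0 {s \<in> plus_vertex v ` std_tet \<union> minus_vertex v ` std_tet. k \<bullet> s = 1})"
    using convex_hull_covered_by_contact_cones[OF fin zero_in_interior_twin_hull[of v, unfolded twin_hull_def] x[unfolded twin_hull_def]]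
    by blast
  have S: "supports v k" using k by (auto simp: supports_def)
  have C: "{s \<in> plus_vertex v ` std_tet \<union> minus_vertex v ` std_tet. k \<bullet> s = 1} = plus_vertex v ` plus_contacts v k \<union> minus_vertex v ` minus_contacts v k"
    by (auto simp: plus_contacts_def minus_contacts_def)
  obtain g where g: "g \<in> face_rotations"
    and P: "g ` plus_contacts v k \<subseteq> {vector [1,1,1], vector [1,-1,-1]}"
    and M: "g ` minus_contacts v k \<subseteq> {vector [-1,1,-1], vector [-1,-1,1]}"
    using contacts_rotate_to_face[OF l S] by blast
  have sym: "tet_symmetry g" by (rule face_rotations_symmetry[OF g])
  then have lin: "linear g" by (simp add: tet_symmetry_def orthogonal_transformation_def)
  note tr = symmetry_transports[OF sym]
  have "g x \<in> g ` (convex hull (insert 0 (plus_vertex v ` plus_contacts v k \<union> minus_vertex v ` minus_contacts v k)))"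
    using xk unfolding C by blast
  also have "\<dots> = convex hull (insert 0 (plus_vertex (g v) ` plus_contacts (g v) (g k) \<union> minus_vertex (g v) ` minus_contacts (g v) (g k)))"
    unfolding convex_hull_linear_image[OF lin] tr(4,5)
    by (simp add: image_Un image_image tr(1,2) linear_0[OF lin])
  also have "\<dots> \<subseteq> face_fan (g v)"
    by (rule face_contacts_subset_fan) (use l S sym P M tr in \<open>simp_all add: tet_symmetry_def\<close>)
  finally show "x \<in> (\<Union>g\<in>face_rotations. g -` face_fan (g v))" using g by blast
qed

lemma lmeasurable_face_fan: "face_fan v \<in> lmeasurable"
  unfolding face_fan_def Let_def by (simp add: fmeasurable.Un lmeasurable_hull_finite)

lemma measure_twin_hull_strict:
  assumes l: "l1_norm v < 1"
  shows "measure lebesgue (twin_hull v) \<le> 8 * (1 + v \<bullet> v)"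
proof -
  have fin: "finite face_rotations" and card: "card face_rotations \<le> 6"
    unfolding face_rotations_def by (simp_all add: card_insert_le_m1)
  have vim: "g -` face_fan (g v) \<in> lmeasurable \<and> measure lebesgue (g -` face_fan (g v)) \<le> 8 * (1 + v \<bullet> v) / 6"
    if "g \<in> face_rotations" for g
  proof -
    have o: "orthogonal_transformation g"
      using face_rotations_symmetry[OF that] by (simp add: tet_symmetry_def)
    then have gg: "g v \<bullet> g v = v \<bullet> v" by (simp add: orthogonal_transformation_def)
    have b: "bij g" by (rule orthogonal_transformation_bij[OF o])
    have i: "orthogonal_transformation (inv g)" by (rule orthogonal_transformation_inv[OF o])
    have e: "g -` face_fan (g v) = inv g ` face_fan (g v)" by (rule bij_vimage_eq_inv_image[OF b])
    show ?thesis
      unfolding e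
      using measure_orthogonal_image[OF i lmeasurable_face_fan] measurable_orthogonal_image[OF i lmeasurable_face_fan]
        measure_face_fan[of "g v"] gg by simp
  qed
  have "measure lebesgue (twin_hull v) \<le> measure lebesgue (\<Union>g\<in>face_rotations. g -` face_fan (g v))"
  proof (rule measure_mono_fmeasurable[OF twin_hull_covered_by_fans[OF l]])
    have "finite (plus_vertex v ` std_tet \<union> minus_vertex v ` std_tet)" by (simp add: std_tet_def)
    then show "twin_hull v \<in> sets lebesgue" unfolding twin_hull_def by (intro fmeasurableD lmeasurable_hull_finite)
    show "(\<Union>g\<in>face_rotations. g -` face_fan (g v)) \<in> lmeasurable"
      using fin vim by (intro fmeasurable.finite_UN) auto
  qed
  also have "\<dots> \<le> (\<Sum>g\<in>face_rotations. measure lebesgue (g -` face_fan (g v)))"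
    using fin vim by (intro measure_UNION_le) (auto simp: fmeasurableD)
  also have "\<dots> \<le> (\<Sum>g\<in>face_rotations. 8 * (1 + v \<bullet> v) / 6)"
    using vim by (intro sum_mono) auto
  also have "\<dots> = card face_rotations * (8 * (1 + v \<bullet> v) / 6)" by simp
  also have "\<dots> \<le> 6 * (8 * (1 + v \<bullet> v) / 6)"
    using card by (intro mult_right_mono) auto
  finally show ?thesis by simp
qed

lemma measure_scaleR_image:
  fixes S :: "(real^3) set"
  assumes "S \<in> lmeasurable"
  shows "measure lebesgue ((\<lambda>x. c *\<^sub>R x) ` S) = \<bar>c\<bar> ^ 3 * measure lebesgue S"
proof -
  have lin: "linear (\<lambda>x::real^3. c *\<^sub>R x)" by (simp add: linear_scaleR)
  have "det (matrix (\<lambda>x::real^3. c *\<^sub>R x)) = c ^ 3"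
    by (simp add: det_3 matrix_def axis_def power3_eq_cube)
  then show ?thesis using measure_linear_image[OF lin assms] by (simp add: power_abs)
qed

lemma lmeasurable_twin_hull: "twin_hull v \<in> lmeasurable"
  unfolding twin_hull_def by (rule lmeasurable_hull_finite) (simp add: std_tet_def)

lemma l1_norm_scaleR: "l1_norm (c *\<^sub>R v) = \<bar>c\<bar> * l1_norm v"
  by (simp add: l1_norm_def abs_mult algebra_simps)

text \<open>The points \<open>\<plusminus>a + a \<times> v\<close> lie on the segment between \<open>\<plusminus>w a + a \<times> v\<close>. This deforms a vector \<open>v\<close> on the boundary of the
octahedron into one in its interior while enlarging the hull.\<close>

lemma twin_hull_subset_scaled:
  assumes "1 \<le> w"
  shows "twin_hull v \<subseteq> (\<lambda>x. w *\<^sub>R x) ` twin_hull ((1 / w) *\<^sub>R v)"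
proof -
  let ?B = "(\<lambda>x. w *\<^sub>R x) ` twin_hull ((1 / w) *\<^sub>R v)"
  have w: "w > 0" using assms by simp
  have cB: "convex ?B" by (simp add: twin_hull_def convex_scaling)
  have c: "w *\<^sub>R plus_vertex ((1 / w) *\<^sub>R v) a = w *\<^sub>R a + cross3 a v" "w *\<^sub>R minus_vertex ((1 / w) *\<^sub>R v) a = cross3 a v - w *\<^sub>R a" for a
    using w by (simp_all add: plus_vertex_def minus_vertex_def cross_mult_right algebra_simps)
  have "plus_vertex v a \<in> ?B \<and> minus_vertex v a \<in> ?B" if "a \<in> std_tet" for a
  proof -
    have "plus_vertex ((1 / w) *\<^sub>R v) a \<in> twin_hull ((1 / w) *\<^sub>R v)" "minus_vertex ((1 / w) *\<^sub>R v) a \<in> twin_hull ((1 / w) *\<^sub>R v)"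
      unfolding twin_hull_def using that by (auto intro!: hull_inc)
    then have in_B: "w *\<^sub>R a + cross3 a v \<in> ?B" "cross3 a v - w *\<^sub>R a \<in> ?B"
      unfolding c[symmetric] by blast+
    have *: "((w + 1) / (2 * w)) *\<^sub>R x + ((w - 1) / (2 * w)) *\<^sub>R y \<in> ?B" if "x \<in> ?B" "y \<in> ?B" for x y
      using that assms w by (intro convexD[OF cB]) (auto simp: field_simps)
    have "plus_vertex v a = ((w + 1) / (2 * w)) *\<^sub>R (w *\<^sub>R a + cross3 a v) + ((w - 1) / (2 * w)) *\<^sub>R (cross3 a v - w *\<^sub>R a)"
      "minus_vertex v a = ((w + 1) / (2 * w)) *\<^sub>R (cross3 a v - w *\<^sub>R a) + ((w - 1) / (2 * w)) *\<^sub>R (w *\<^sub>R a + cross3 a v)"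
      using w by (simp_all add: plus_vertex_def minus_vertex_def vec_eq_iff field_simps)
    then show ?thesis using *[OF in_B] *[OF in_B(2,1)] by simp
  qed
  then show ?thesis unfolding twin_hull_def[of v] by (intro hull_minimal cB) auto
qed

lemma measure_twin_hull:
  assumes "l1_norm v \<le> 1"
  shows "measure lebesgue (twin_hull v) \<le> 8 * (1 + v \<bullet> v)"
proof -
  have le: "measure lebesgue (twin_hull v) \<le> 8 * (w ^ 3 + w * (v \<bullet> v))" if w: "1 < w" for w
  proof -
    have "l1_norm ((1 / w) *\<^sub>R v) < 1"
      using assms w by (simp add: l1_norm_scaleR)
    then have b: "measure lebesgue (twin_hull ((1 / w) *\<^sub>R v)) \<le> 8 * (1 + (v \<bullet> v) / w\<^sup>2)"
      using measure_twin_hull_strict[of "(1 / w) *\<^sub>R v"] by (simp add: power2_eq_square)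
    have "measure lebesgue (twin_hull v) \<le> measure lebesgue ((\<lambda>x. w *\<^sub>R x) ` twin_hull ((1 / w) *\<^sub>R v))"
      using w lmeasurable_twin_hull
      by (intro measure_mono_fmeasurable twin_hull_subset_scaled measurable_linear_image)
        (auto simp: linear_scaleR fmeasurableD)
    also have "\<dots> \<le> w ^ 3 * (8 * (1 + (v \<bullet> v) / w\<^sup>2))"
      using w b by (simp add: measure_scaleR_image[OF lmeasurable_twin_hull])
    also have "\<dots> = 8 * (w ^ 3 + w * (v \<bullet> v))"
      using w by (simp add: field_simps power2_eq_square power3_eq_cube)
    finally show ?thesis .
  qed
  have "((\<lambda>w. 8 * (w ^ 3 + w * (v \<bullet> v))) \<longlongrightarrow> 8 * (1 ^ 3 + 1 * (v \<bullet> v))) (at_right 1)"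
    by (intro tendsto_intros)
  moreover have "eventually (\<lambda>w. measure lebesgue (twin_hull v) \<le> 8 * (w ^ 3 + w * (v \<bullet> v))) (at_right 1)"
    using eventually_at_right_less[of "1::real"] by eventually_elim (rule le)
  ultimately show ?thesis using tendsto_lowerbound by fastforce
qed

section \<open>Choosing the labelling of the second tetrahedron\<close>

text \<open>The vector \<open>s\<close> is the axial vector of \<open>R - transpose R\<close>, and \<open>s / T\<close> is the Cayley vector of \<open>R\<close>, that is
\<open>(1 - X) R = 1 + X\<close> for the matrix \<open>X\<close> of the cross product with it. Multiplying by \<open>T\<close> avoids the division. All
identities follow from orthogonality and from \<open>R\<close> being its own cofactor matrix.\<close>

lemma cayley_parameters:
  fixes R :: "real^3^3"
  assumes rot: "rotation_matrix R"
  defines "T \<equiv> 1 + (R$1$1 + R$2$2 + R$3$3)"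
  defines "s \<equiv> vector [R$3$2 - R$2$3, R$1$3 - R$3$1, R$2$1 - R$1$2] :: real^3"
  shows "T *\<^sub>R (R *v a) + cross3 (R *v a) s = T *\<^sub>R a - cross3 a s"
    and "T * (R$1$2 + R$2$1) = s$1 * s$2" "T * (R$2$3 + R$3$2) = s$2 * s$3" "T * (R$3$1 + R$1$3) = s$3 * s$1"
    and "4 * T = T\<^sup>2 + ((s$1)\<^sup>2 + (s$2)\<^sup>2 + (s$3)\<^sup>2)"
proof -
  obtain a11 a12 a13 a21 a22 a23 a31 a32 a33 where
    R: "R$1$1 = a11" "R$1$2 = a12" "R$1$3 = a13" "R$2$1 = a21" "R$2$2 = a22" "R$2$3 = a23" "R$3$1 = a31" "R$3$2 = a32" "R$3$3 = a33"
    by blast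
  have "R ** transpose R = mat 1" "transpose R ** R = mat 1" 
    using rot by (simp_all add: rotation_matrix_def orthogonal_matrix_def)
  then have o: "a11*a11 + a12*a12 + a13*a13 = 1" "a21*a21 + a22*a22 + a23*a23 = 1" "a31*a31 + a32*a32 + a33*a33 = 1"
    "a11*a21 + a12*a22 + a13*a23 = 0" "a11*a31 + a12*a32 + a13*a33 = 0" "a21*a31 + a22*a32 + a23*a33 = 0"
    "a11*a11 + a21*a21 + a31*a31 = 1" "a12*a12 + a22*a22 + a32*a32 = 1" "a13*a13 + a23*a23 + a33*a33 = 1"
    "a11*a12 + a21*a22 + a31*a32 = 0" "a11*a13 + a21*a23 + a31*a33 = 0" "a12*a13 + a22*a23 + a32*a33 = 0"
    by (simp_all add: vec_eq_iff forall_3 matrix_matrix_mult_def transpose_def mat_def sum_3 R)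
  have "cross3 (R *v x) (R *v y) = R *v (cross3 x y)" for x y
    using rot by (rule cross_rotation_matrix)
  from this[of "axis 1 1" "axis 2 1"] this[of "axis 2 1" "axis 3 1"] this[of "axis 3 1" "axis 1 1"]
  have c: "a13 = a21*a32 - a31*a22" "a23 = a31*a12 - a11*a32" "a33 = a11*a22 - a21*a12"
    "a11 = a22*a33 - a32*a23" "a21 = a32*a13 - a12*a33" "a31 = a12*a23 - a22*a13"
    "a12 = a23*a31 - a33*a21" "a22 = a33*a11 - a13*a31" "a32 = a13*a21 - a23*a11"
    by (simp_all add: cross_basis matrix_vector_mul_component vec_eq_iff forall_3 cross_components inner_axis R mult.commute)
  have S: "s$1 = a32 - a23" "s$2 = a13 - a31" "s$3 = a21 - a12" by (simp_all add: s_def R)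
  have T: "T = 1 + (a11 + a22 + a33)" by (simp add: T_def R)
  show "T * (R$1$2 + R$2$1) = s$1 * s$2"
    unfolding T S R using c(5) c(7) o(10) o(4) by algebra
  show "T * (R$2$3 + R$3$2) = s$2 * s$3"
    unfolding T S R using c(9) c(2) o(12) o(6) by algebra
  show "T * (R$3$1 + R$1$3) = s$3 * s$1"
    unfolding T S R using c(1) c(6) o(11) o(5) by algebra
  show "4 * T = T\<^sup>2 + ((s$1)\<^sup>2 + (s$2)\<^sup>2 + (s$3)\<^sup>2)"
    unfolding T S R using o(1) o(2) o(3) c(3) c(8) c(4) by algebra
  have m1: "T * a11 + a21 * s$3 - a31 * s$2 = T"
    unfolding T S R using o(7) c(3) c(8) by algebra
  have m2: "T * a12 + a22 * s$3 - a32 * s$2 = - s$3"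
    unfolding T S R using o(10) c(5) by algebra
  have m3: "T * a13 + a23 * s$3 - a33 * s$2 = s$2"
    unfolding T S R using o(11) c(6) by algebra
  have m4: "T * a21 + a31 * s$1 - a11 * s$3 = s$3"
    unfolding T S R using o(10) c(7) by algebra
  have m5: "T * a22 + a32 * s$1 - a12 * s$3 = T"
    unfolding T S R using o(8) c(3) c(4) by algebra
  have m6: "T * a23 + a33 * s$1 - a13 * s$3 = - s$1"
    unfolding T S R using o(12) c(9) by algebra
  have m7: "T * a31 + a11 * s$2 - a21 * s$1 = - s$2"
    unfolding T S R using o(11) c(1) by algebra
  have m8: "T * a32 + a12 * s$2 - a22 * s$1 = s$1"
    unfolding T S R using o(12) c(2) by algebra
  have m9: "T * a33 + a13 * s$2 - a23 * s$1 = T"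
    unfolding T S R using o(9) c(8) c(4) by algebra
  note m = m1 m2 m3 m4 m5 m6 m7 m8 m9
  have lin: "T * (x * u1 + y * u2 + z * u3) + (x * v1 + y * v2 + z * v3) * s' - (x * w1 + y * w2 + z * w3) * s'' =
      x * (T * u1 + v1 * s' - w1 * s'') + y * (T * u2 + v2 * s' - w2 * s'') + z * (T * u3 + v3 * s' - w3 * s'')"
    for x y z u1 u2 u3 v1 v2 v3 w1 w2 w3 s' s'' :: real
    by (simp add: algebra_simps)
  have Ra: "(R *v a) $ 1 = a$1 * a11 + a$2 * a12 + a$3 * a13" "(R *v a) $ 2 = a$1 * a21 + a$2 * a22 + a$3 * a23"
    "(R *v a) $ 3 = a$1 * a31 + a$2 * a32 + a$3 * a33"
    by (simp_all add: matrix_vector_mult_def sum_3 R mult.commute)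
  show "T *\<^sub>R (R *v a) + cross3 (R *v a) s = T *\<^sub>R a - cross3 a s"
    using lin[of "a$1" a11 "a$2" a12 "a$3" a13 a21 a22 a23 "s$3" a31 a32 a33 "s$2"]
      lin[of "a$1" a21 "a$2" a22 "a$3" a23 a31 a32 a33 "s$1" a11 a12 a13 "s$3"]
      lin[of "a$1" a31 "a$2" a32 "a$3" a33 a11 a12 a13 "s$2" a21 a22 a23 "s$1"]
    unfolding m by (simp add: vec_eq_iff forall_3 cross_components Ra algebra_simps)
qed

text \<open>The first difference is \<open>(T - x) (3 T + x)\<close>, and the second one is the same with \<open>-x\<close>.\<close>

lemma abs_le_of_signed_squares:
  fixes T x :: real
  assumes "0 < T" "3 * T\<^sup>2 - x\<^sup>2 \<ge> 2 * T * x" "3 * T\<^sup>2 - x\<^sup>2 \<ge> - (2 * T * x)"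
  shows "\<bar>x\<bar> \<le> T"
proof (rule ccontr)
  assume "\<not> \<bar>x\<bar> \<le> T"
  then have "(T - \<bar>x\<bar>) * (3 * T + \<bar>x\<bar>) < 0"
    using assms(1) by (intro mult_neg_pos) auto
  moreover have "(T - \<bar>x\<bar>) * (3 * T + \<bar>x\<bar>) = 3 * T\<^sup>2 - x\<^sup>2 - 2 * T * \<bar>x\<bar>"
    by (simp add: power2_eq_square algebra_simps)
  moreover have "2 * T * \<bar>x\<bar> \<le> 3 * T\<^sup>2 - x\<^sup>2" using assms(2,3) by (simp add: abs_if)
  ultimately show False by linarith
qed

text \<open>The signed sums of three entries are the traces of \<open>R\<close> composed with the eight rotations of order three that preserve
\<open>std_tet\<close>. Four of them add up to zero, so the trace of \<open>R\<close> is nonnegative and \<open>R\<close> is not a half-turn; this is what makes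
the Cayley vector exist. In terms of \<open>s\<close>, a rotation and its inverse together bound one signed sum of
the coordinates of \<open>s\<close>, up to its overall sign, by \<open>T\<close>.\<close>

lemma cayley_vector_in_octahedron:
  fixes R :: "real^3^3"
  assumes rot: "rotation_matrix R"
    and max: "\<And>e1 e2 e3. {e1, e2, e3} \<subseteq> {1, -1} \<Longrightarrow> e1 * e2 * e3 = 1 \<Longrightarrow>
      e1 * R$2$1 + e2 * R$3$2 + e3 * R$1$3 \<le> trace R \<and> e1 * R$3$1 + e2 * R$1$2 + e3 * R$2$3 \<le> trace R"
  obtains v where "l1_norm v \<le> 1" "\<And>a. R *v a + cross3 (R *v a) v = a - cross3 a v"
proof -
  define t where "t = R$1$1 + R$2$2 + R$3$3"
  define T where "T = 1 + t"
  define s :: "real^3" where "s = vector [R$3$2 - R$2$3, R$1$3 - R$3$1, R$2$1 - R$1$2]"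
  note cay = cayley_parameters[OF rot, folded t_def, folded T_def s_def]
  have tr: "trace R = t" by (simp add: trace_def sum_3 t_def)
  note m1 = max[of 1 1 1, simplified tr] and m2 = max[of 1 "-1" "-1", simplified tr]
    and m3 = max[of "-1" 1 "-1", simplified tr] and m4 = max[of "-1" "-1" 1, simplified tr]
  have t0: "0 \<le> t" using m1 m2 m3 m4 by simp
  then have T0: "0 < T" by (simp add: T_def)
  have sc: "s$1 = R$3$2 - R$2$3" "s$2 = R$1$3 - R$3$1" "s$3 = R$2$1 - R$1$2" by (simp_all add: s_def)
  have tT: "4 * (T * t) = 3 * T\<^sup>2 - ((s$1)\<^sup>2 + (s$2)\<^sup>2 + (s$3)\<^sup>2)"
    using cay(5) by (simp add: T_def power2_eq_square algebra_simps)
  have key: "\<bar>e2 * s$1 + e3 * s$2 + e1 * s$3\<bar> \<le> T"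
    if e: "e1 * e1 = 1" "e2 * e2 = 1" "e3 * e3 = 1" "e1 * e2 = e3" "e2 * e3 = e1" "e3 * e1 = e2"
      and a: "e1 * R$2$1 + e2 * R$3$2 + e3 * R$1$3 \<le> t" and b: "e3 * R$3$1 + e1 * R$1$2 + e2 * R$2$3 \<le> t"
    for e1 e2 e3
  proof (rule abs_le_of_signed_squares[OF T0])
    define x where "x = e2 * s$1 + e3 * s$2 + e1 * s$3"
    define y where "y = e1 * (R$1$2 + R$2$1) + e2 * (R$2$3 + R$3$2) + e3 * (R$3$1 + R$1$3)"
    have Ty: "T * y = e1 * (s$1 * s$2) + e2 * (s$2 * s$3) + e3 * (s$3 * s$1)"
      unfolding y_def cay(2-4)[symmetric] by (simp add: algebra_simps)
    have "x\<^sup>2 = (e2 * e2) * (s$1)\<^sup>2 + (e3 * e3) * (s$2)\<^sup>2 + (e1 * e1) * (s$3)\<^sup>2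
        + 2 * ((e2 * e3) * (s$1 * s$2) + (e3 * e1) * (s$2 * s$3) + (e1 * e2) * (s$3 * s$1))"
      unfolding x_def by (simp add: power2_eq_square algebra_simps)
    then have x2: "x\<^sup>2 = (s$1)\<^sup>2 + (s$2)\<^sup>2 + (s$3)\<^sup>2 + 2 * (T * y)"
      unfolding e Ty by simp
    have "y + x \<le> 2 * t" "y - x \<le> 2 * t"
      using a b unfolding x_def y_def sc by (simp_all add: algebra_simps)
    then have "T * (y + x) \<le> T * (2 * t)" "T * (y - x) \<le> T * (2 * t)"
      using T0 by (intro mult_left_mono; simp)+
    then have "T * y + T * x \<le> 2 * (T * t)" "T * y - T * x \<le> 2 * (T * t)"
      by (simp_all add: algebra_simps)
    then show "2 * T * (e2 * s$1 + e3 * s$2 + e1 * s$3) \<le> 3 * T\<^sup>2 - (e2 * s$1 + e3 * s$2 + e1 * s$3)\<^sup>2"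
      "- (2 * T * (e2 * s$1 + e3 * s$2 + e1 * s$3)) \<le> 3 * T\<^sup>2 - (e2 * s$1 + e3 * s$2 + e1 * s$3)\<^sup>2"
      unfolding x_def[symmetric] using x2 tT by (simp_all add: algebra_simps)
  qed
  have "\<bar>s$1 + s$2 + s$3\<bar> \<le> T" using key[of 1 1 1] m1 by simp
  moreover have "\<bar>- s$1 - s$2 + s$3\<bar> \<le> T" using key[of 1 "-1" "-1"] m2 m3 m4 by simp
  moreover have "\<bar>s$1 - s$2 - s$3\<bar> \<le> T" using key[of "-1" 1 "-1"] m2 m3 m4 by simp
  moreover have "\<bar>- s$1 + s$2 - s$3\<bar> \<le> T" using key[of "-1" "-1" 1] m2 m3 m4 by simp
  ultimately have l: "l1_norm s \<le> T" unfolding l1_norm_def by (simp add: abs_if split: if_splits)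
  show ?thesis
  proof
    show "l1_norm ((1 / T) *\<^sub>R s) \<le> 1" using l T0 by (simp add: l1_norm_scaleR)
    show "R *v a + cross3 (R *v a) ((1 / T) *\<^sub>R s) = a - cross3 a ((1 / T) *\<^sub>R s)" for a
    proof -
      have "(1 / T) *\<^sub>R (T *\<^sub>R (R *v a) + cross3 (R *v a) s) = (1 / T) *\<^sub>R (T *\<^sub>R a - cross3 a s)"
        by (simp only: cay(1))
      then show ?thesis using T0 by (simp add: cross_mult_right algebra_simps)
    qed
  qed
qed

lemma measure_hull_of_cayley:
  assumes v: "l1_norm v \<le> 1" "\<And>a. R *v a + cross3 (R *v a) v = a - cross3 a v"
  shows "measure lebesgue (convex hull (std_tet \<union> (\<lambda>a. - (R *v a)) ` std_tet)) \<le> 8"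
proof -
  let ?S = "std_tet \<union> (\<lambda>a. - (R *v a)) ` std_tet"
  have "plus_vertex v (- (R *v a)) = minus_vertex v a" for a
    using arg_cong[OF v(2)[of a], of uminus] by (simp add: plus_vertex_def minus_vertex_def algebra_simps)
  then have "plus_vertex v ` ?S = plus_vertex v ` std_tet \<union> minus_vertex v ` std_tet" by (simp add: image_Un image_image)
  then have "twin_hull v = plus_vertex v ` (convex hull ?S)"
    by (simp add: twin_hull_def convex_hull_linear_image[OF linear_plus_vertex])
  moreover have "convex hull ?S \<in> lmeasurable" by (rule lmeasurable_hull_finite) (simp add: std_tet_def)
  ultimately have "measure lebesgue (twin_hull v) = \<bar>1 + v \<bullet> v\<bar> * measure lebesgue (convex hull ?S)"
    using measure_linear_image[OF linear_plus_vertex[of v]] det_plus_vertex[of v] by simp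
  moreover have "0 < 1 + v \<bullet> v" using inner_ge_zero[of v] by linarith
  ultimately have "(1 + v \<bullet> v) * measure lebesgue (convex hull ?S) \<le> (1 + v \<bullet> v) * 8"
    using measure_twin_hull[OF v(1)] by (simp add: mult.commute)
  then show ?thesis by (rule mult_left_le_imp_le) fact
qed

text \<open>For signs with product \<open>1\<close>, the matrices of the eight rotations of order three that preserve \<open>std_tet\<close>.\<close>

definition cycle_matrix :: "real \<Rightarrow> real \<Rightarrow> real \<Rightarrow> real^3^3" where
  "cycle_matrix e1 e2 e3 = vector [vector [0, e1, 0], vector [0, 0, e2], vector [e3, 0, 0]]"
definition cycle_matrix' :: "real \<Rightarrow> real \<Rightarrow> real \<Rightarrow> real^3^3" where
  "cycle_matrix' e1 e2 e3 = vector [vector [0, 0, e1], vector [e2, 0, 0], vector [0, e3, 0]]"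

lemma cycle_matrix_symmetry:
  assumes e: "{e1, e2, e3} \<subseteq> {1, -1}" "e1 * e2 * e3 = 1"
  shows "rotation_matrix (cycle_matrix e1 e2 e3)" "(*v) (cycle_matrix e1 e2 e3) ` std_tet = std_tet"
    "rotation_matrix (cycle_matrix' e1 e2 e3)" "(*v) (cycle_matrix' e1 e2 e3) ` std_tet = std_tet"
proof -
  have c: "cycle_matrix e1 e2 e3 *v vector [x, y, z] = vector [e1 * y, e2 * z, e3 * x]"
    "cycle_matrix' e1 e2 e3 *v vector [x, y, z] = vector [e1 * z, e2 * x, e3 * y]" for x y z
    by (simp_all add: cycle_matrix_def cycle_matrix'_def vec_eq_iff forall_3 matrix_vector_mult_def sum_3)
  have cases: "(e1, e2, e3) \<in> {(1,1,1), (1,-1,-1), (-1,1,-1), (-1,-1,1)}" using e by auto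
  show "(*v) (cycle_matrix e1 e2 e3) ` std_tet = std_tet" "(*v) (cycle_matrix' e1 e2 e3) ` std_tet = std_tet"
    using cases by (auto simp: std_tet_def c)
  show "rotation_matrix (cycle_matrix e1 e2 e3)" "rotation_matrix (cycle_matrix' e1 e2 e3)"
    using cases unfolding rotation_matrix_def orthogonal_matrix
    by (auto simp: cycle_matrix_def cycle_matrix'_def det_3 vec_eq_iff forall_3 matrix_matrix_mult_def
        transpose_def mat_def sum_3)
qed

lemma trace_cycle_matrix:
  "trace (R ** cycle_matrix e1 e2 e3) = e1 * R$2$1 + e2 * R$3$2 + e3 * R$1$3"
  "trace (R ** cycle_matrix' e1 e2 e3) = e1 * R$3$1 + e2 * R$1$2 + e3 * R$2$3"
  by (simp_all add: trace_def sum_3 matrix_matrix_mult_def cycle_matrix_def cycle_matrix'_def)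

text \<open>The vertices of a regular tetrahedron form a tight frame.\<close>

lemma std_tet_frame: "(\<Sum>a\<in>std_tet. (a \<bullet> x) *\<^sub>R a) = 4 *\<^sub>R x"
  by (simp add: std_tet_def vector3_eq_iff vec_eq_iff forall_3 inner_vec_def sum_3)

lemma trace_eq_sum_std_tet: "trace R = (\<Sum>a\<in>std_tet. a \<bullet> (R *v a)) / 4"
  by (simp add: std_tet_def vector3_eq_iff trace_def sum_3 inner_vec_def matrix_vector_mult_def)

text \<open>Among the rotations \<open>R\<close> with \<open>-R\<close> carrying \<open>std_tet\<close> to the second vertex set, take one of largest trace. The
maximum exists because the trace depends only on the images of the four vertices.\<close>

lemma measure_hull_std_tet_orthogonal_image:
  assumes h: "orthogonal_transformation h"
  shows "measure lebesgue (convex hull (std_tet \<union> h ` std_tet)) \<le> 8"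
proof -
  define Y where "Y = h ` std_tet"
  define \<R> where "\<R> = {R. rotation_matrix R \<and> (\<lambda>a. - (R *v a)) ` std_tet = Y}"
  define H where "H = matrix h"
  have H: "orthogonal_matrix H" "\<And>x. h x = H *v x"
    using h by (simp_all add: H_def orthogonal_transformation_matrix matrix_works)
  have neg: "H *v (- x) = - (H *v x)" for x
    unfolding H(2)[symmetric] using h by (intro linear_neg orthogonal_transformation_linear)
  have "\<R> \<noteq> {}"
  proof (cases "det H = 1")
    case True
    \<comment> \<open>The negative of the reflection that swaps two vertices, to correct the orientation.\<close>
    define s :: "real^3^3" where "s = vector [vector [-1, 0, 0], vector [0, 0, -1], vector [0, -1, 0]]"
    have sv: "s *v vector [x, y, z] = vector [-x, -z, -y]" for x y z
      by (simp add: s_def vec_eq_iff forall_3 matrix_vector_mult_def sum_3)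
    have "- vector [x, y, z] = (vector [-x, -y, -z] :: real^3)" for x y z
      by (simp add: vec_eq_iff forall_3)
    then have "(\<lambda>a. - (s *v a)) ` std_tet = std_tet"
      by (auto simp: std_tet_def sv)
    moreover have "(\<lambda>a. - ((H ** s) *v a)) ` std_tet = h ` ((\<lambda>a. - (s *v a)) ` std_tet)"
      by (simp add: image_image neg H(2) matrix_vector_mul_assoc)
    moreover have "det s = 1" by (simp add: s_def det_3)
    moreover have "orthogonal_matrix s"
      unfolding orthogonal_matrix
      by (simp add: s_def vec_eq_iff forall_3 matrix_matrix_mult_def transpose_def mat_def sum_3)
    ultimately have "H ** s \<in> \<R>"
      using True H(1) by (simp add: \<R>_def Y_def rotation_matrix_def orthogonal_matrix_mul det_mul)
    then show ?thesis by blast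
  next
    case False
    then have d: "det H = -1" using det_orthogonal_matrix[OF H(1)] by blast
    have "orthogonal_matrix (- H)"
      using H(1) by (simp add: orthogonal_matrix vec_eq_iff matrix_matrix_mult_def transpose_def)
    moreover have "det (- H) = 1" using d by (simp add: det_3)
    moreover have "- ((- H) *v a) = h a" for a
      by (simp add: H(2) matrix_vector_mult_def sum_negf vec_eq_iff)
    then have "(\<lambda>a. - ((- H) *v a)) ` std_tet = Y" by (simp add: Y_def)
    ultimately have "- H \<in> \<R>" by (simp add: \<R>_def rotation_matrix_def)
    then show ?thesis by blast
  qed
  have "trace ` \<R> \<subseteq> (\<lambda>f. (\<Sum>a\<in>std_tet. - (a \<bullet> f a)) / 4) ` (std_tet \<rightarrow>\<^sub>E Y)"
  proof
    fix t assume "t \<in> trace ` \<R>"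
    then obtain R where R: "R \<in> \<R>" "t = trace R" by blast
    have "restrict (\<lambda>a. - (R *v a)) std_tet \<in> std_tet \<rightarrow>\<^sub>E Y" using R(1) by (auto simp: \<R>_def)
    moreover have "t = (\<Sum>a\<in>std_tet. - (a \<bullet> restrict (\<lambda>a. - (R *v a)) std_tet a)) / 4"
      by (simp add: R(2) trace_eq_sum_std_tet)
    ultimately show "t \<in> (\<lambda>f. (\<Sum>a\<in>std_tet. - (a \<bullet> f a)) / 4) ` (std_tet \<rightarrow>\<^sub>E Y)" by blast
  qed
  moreover have "finite (std_tet \<rightarrow>\<^sub>E Y)" by (intro finite_PiE) (simp_all add: Y_def std_tet_def)
  ultimately have fin: "finite (trace ` \<R>)" using finite_surj by blast
  have "Max (trace ` \<R>) \<in> trace ` \<R>" using fin \<open>\<R> \<noteq> {}\<close> by (intro Max_in) auto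
  then obtain R where R1: "R \<in> \<R>" "trace R = Max (trace ` \<R>)" by force
  have R: "R \<in> \<R>" "\<And>R'. R' \<in> \<R> \<Longrightarrow> trace R' \<le> trace R"
    using R1 Max_ge[OF fin] by auto
  have rot: "rotation_matrix R" and img: "(\<lambda>a. - (R *v a)) ` std_tet = Y" using R(1) by (auto simp: \<R>_def)
  have comp: "R ** C \<in> \<R>" if C: "rotation_matrix C" "(*v) C ` std_tet = std_tet" for C
  proof -
    have "(\<lambda>a. - ((R ** C) *v a)) ` std_tet = (\<lambda>a. - (R *v a)) ` ((*v) C ` std_tet)"
      by (simp add: image_image matrix_vector_mul_assoc)
    then show ?thesis
      using rot C img by (simp add: \<R>_def rotation_matrix_def orthogonal_matrix_mul det_mul)
  qed
  have "e1 * R$2$1 + e2 * R$3$2 + e3 * R$1$3 \<le> trace R \<and> e1 * R$3$1 + e2 * R$1$2 + e3 * R$2$3 \<le> trace R"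
    if "{e1, e2, e3} \<subseteq> {1, -1}" "e1 * e2 * e3 = 1" for e1 e2 e3
    using R(2)[OF comp] cycle_matrix_symmetry[OF that] trace_cycle_matrix[of R e1 e2 e3] by metis
  then obtain v where "l1_norm v \<le> 1" "\<And>a. R *v a + cross3 (R *v a) v = a - cross3 a v"
    using cayley_vector_in_octahedron[OF rot] by blast
  from measure_hull_of_cayley[OF this] show ?thesis unfolding img Y_def .
qed

section \<open>Regular tetrahedra and cubes in the unit sphere\<close>

text \<open>Distinct vertices have the same inner product \<open>c\<close>. Four vectors in space are linearly dependent; pairing a dependency with
each vertex shows that its coefficients are all equal, so the vertices sum to zero and \<open>c = -1/3\<close>. These are the
inner products of the standard tetrahedron scaled to the unit sphere, and the tight frame extends a bijection of the
vertices to an isometry.\<close>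

lemma regular_tetrahedron_inscribed:
  assumes "regular_tetrahedron S" "inscribed_in_unit_sphere S"
  obtains f where "orthogonal_transformation f" "vertices S = (\<lambda>x. (1 / sqrt 3) *\<^sub>R f x) ` std_tet"
proof -
  obtain C where C: "\<not> affine_dependent C" "int (card C) = 3 + 1" "S = convex hull C"
    using assms(1) by (auto simp: regular_tetrahedron_def simplex_def)
  have fin: "finite C" and card: "card C = 4" using C(2) by (auto intro: card_ge_0_finite)
  have V: "vertices S = C"
    using extreme_point_of_convex_hull_affine_independent[OF C(1)] by (simp add: vertices_def C(3))
  obtain d where d: "\<And>x y. x \<in> C \<Longrightarrow> y \<in> C \<Longrightarrow> x \<noteq> y \<Longrightarrow> dist x y = d"
    using assms(1) unfolding regular_tetrahedron_def V by metis
  have unit: "x \<bullet> x = 1" if "x \<in> C" for x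
  proof -
    have "x \<in> sphere 0 1" using assms(2) that unfolding inscribed_in_unit_sphere_def V by blast
    then show ?thesis by (simp add: norm_eq_1)
  qed
  define c where "c = 1 - d\<^sup>2 / 2"
  have inner: "x \<bullet> y = c" if "x \<in> C" "y \<in> C" "x \<noteq> y" for x y
  proof -
    have "d\<^sup>2 = (x - y) \<bullet> (x - y)" unfolding d[OF that, symmetric] dist_norm by (rule power2_norm_eq_inner)
    also have "\<dots> = 2 - 2 * (x \<bullet> y)" using unit that by (simp add: algebra_simps inner_commute)
    finally show ?thesis by (simp add: c_def field_simps)
  qed
  have c1: "c \<noteq> 1"
  proof -
    obtain x y where "x \<in> C" "y \<in> C" "x \<noteq> y"
      using card card_le_Suc0_iff_eq[OF fin] by auto
    then have "d \<noteq> 0" using d[of x y] by auto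
    then show ?thesis by (simp add: c_def)
  qed
  have "dependent C" using card fin by (intro dependent_biggerset) simp
  then obtain u where u: "\<exists>v\<in>C. u v \<noteq> 0" "(\<Sum>v\<in>C. u v *\<^sub>R v) = 0"
    unfolding real_vector.dependent_finite[OF fin] by blast
  have ux: "u x * (1 - c) = - c * sum u C" if "x \<in> C" for x
  proof -
    have "0 = (\<Sum>v\<in>C. u v *\<^sub>R v) \<bullet> x" by (simp add: u(2))
    also have "\<dots> = (\<Sum>v\<in>C. u v * (v \<bullet> x))" by (simp add: inner_sum_left)
    also have "\<dots> = u x * (x \<bullet> x) + (\<Sum>v\<in>C - {x}. u v * (v \<bullet> x))" by (rule sum.remove[OF fin that])
    also have "(\<Sum>v\<in>C - {x}. u v * (v \<bullet> x)) = (\<Sum>v\<in>C - {x}. u v * c)"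
      using that inner by (intro sum.cong) auto
    also have "\<dots> = (sum u C - u x) * c" by (simp add: sum_distrib_right[symmetric] sum_diff1 fin that)
    finally show ?thesis using unit[OF that] by (simp add: algebra_simps)
  qed
  define \<kappa> where "\<kappa> = - c * sum u C / (1 - c)"
  have u\<kappa>: "u x = \<kappa>" if "x \<in> C" for x using ux[OF that] c1 by (simp add: \<kappa>_def field_simps)
  then have "\<kappa> \<noteq> 0" using u(1) by auto
  have "sum u C = 4 * \<kappa>" using u\<kappa> card by simp
  moreover have "\<kappa> * (1 - c) = - c * sum u C" using c1 by (simp add: \<kappa>_def)
  ultimately have "\<kappa> * (3 * c + 1) = 0" by (simp add: algebra_simps)
  then have c3: "c = - 1 / 3" using \<open>\<kappa> \<noteq> 0\<close> by simp
  have "\<kappa> *\<^sub>R \<Sum>C = 0" using u(2) u\<kappa> by (simp add: scaleR_sum_right)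
  then have sumC: "\<Sum>C = 0" using \<open>\<kappa> \<noteq> 0\<close> by simp
  obtain \<phi> where \<phi>: "bij_betw \<phi> std_tet C"
    using finite_same_card_bij[of std_tet C] fin card card_std_tet by (auto simp: std_tet_def)
  have ftet: "finite std_tet" by (simp add: std_tet_def)
  have tin: "a \<bullet> b = (if a = b then 3 else - 1)" if "a \<in> std_tet" "b \<in> std_tet" for a b
    using that by (auto simp: std_tet_def inner_vec_def sum_3 vector3_eq_iff)
  have \<phi>in: "\<phi> a \<bullet> \<phi> b = (a \<bullet> b) / 3" if "a \<in> std_tet" "b \<in> std_tet" for a b
  proof -
    have "\<phi> a = \<phi> b \<longleftrightarrow> a = b" using \<phi> that by (auto simp: bij_betw_def inj_on_def)
    moreover have "\<phi> a \<in> C" "\<phi> b \<in> C" using \<phi> that by (auto simp: bij_betw_def)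
    ultimately show ?thesis using tin[OF that] unit inner c3 by auto
  qed
  define f where "f = (\<lambda>y. (sqrt 3 / 4) *\<^sub>R (\<Sum>a\<in>std_tet. (a \<bullet> y) *\<^sub>R \<phi> a))"
  have "linear f"
  proof (rule linearI)
    show "f (x + y) = f x + f y" for x y
      by (simp add: f_def inner_add_right scaleR_add_left sum.distrib scaleR_add_right)
    show "f (r *\<^sub>R x) = r *\<^sub>R f x" for r x
      by (simp add: f_def scaleR_sum_right mult_ac)
  qed
  moreover have "f x \<bullet> f y = x \<bullet> y" for x y
  proof -
    have sq: "sqrt 3 / 4 * (sqrt 3 / 4 * t) = 3 / 16 * t" for t
      unfolding mult.assoc[symmetric] by simp
    have "f x \<bullet> f y = 3 / 16 * ((\<Sum>a\<in>std_tet. (a \<bullet> x) *\<^sub>R \<phi> a) \<bullet> (\<Sum>b\<in>std_tet. (b \<bullet> y) *\<^sub>R \<phi> b))"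
      unfolding f_def inner_scaleR_left inner_scaleR_right sq ..
    also have "(\<Sum>a\<in>std_tet. (a \<bullet> x) *\<^sub>R \<phi> a) \<bullet> (\<Sum>b\<in>std_tet. (b \<bullet> y) *\<^sub>R \<phi> b)
        = (\<Sum>a\<in>std_tet. \<Sum>b\<in>std_tet. (a \<bullet> x) * ((b \<bullet> y) * (\<phi> a \<bullet> \<phi> b)))"
      unfolding inner_sum_left by (simp add: inner_sum_right sum_distrib_left mult.left_commute)
    also have "(\<Sum>a\<in>std_tet. \<Sum>b\<in>std_tet. (a \<bullet> x) * ((b \<bullet> y) * (\<phi> a \<bullet> \<phi> b)))
        = (\<Sum>a\<in>std_tet. (a \<bullet> x) * ((a \<bullet> (\<Sum>b\<in>std_tet. (b \<bullet> y) *\<^sub>R b)) / 3))"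
    proof (rule sum.cong[OF refl])
      fix a assume a: "a \<in> std_tet"
      have "(\<Sum>b\<in>std_tet. (b \<bullet> y) * (\<phi> a \<bullet> \<phi> b)) = (\<Sum>b\<in>std_tet. (b \<bullet> y) * (a \<bullet> b) / 3)"
        using \<phi>in[OF a] by (intro sum.cong) auto
      also have "\<dots> = (a \<bullet> (\<Sum>b\<in>std_tet. (b \<bullet> y) *\<^sub>R b)) / 3"
        by (simp add: inner_sum_right sum_divide_distrib)
      finally show "(\<Sum>b\<in>std_tet. (a \<bullet> x) * ((b \<bullet> y) * (\<phi> a \<bullet> \<phi> b)))
          = (a \<bullet> x) * ((a \<bullet> (\<Sum>b\<in>std_tet. (b \<bullet> y) *\<^sub>R b)) / 3)"
        by (simp only: sum_distrib_left[symmetric])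
    qed
    also have "\<dots> = (4 / 3) * (\<Sum>a\<in>std_tet. (a \<bullet> x) * (a \<bullet> y))"
      by (simp add: std_tet_frame sum_distrib_left mult_ac)
    also have "(\<Sum>a\<in>std_tet. (a \<bullet> x) * (a \<bullet> y)) = (\<Sum>a\<in>std_tet. (a \<bullet> x) *\<^sub>R a) \<bullet> y"
      by (simp add: inner_sum_left)
    also have "\<dots> = 4 * (x \<bullet> y)" by (simp add: std_tet_frame)
    finally show ?thesis by simp
  qed
  ultimately have orth: "orthogonal_transformation f" by (simp add: orthogonal_transformation_def)
  have f\<phi>: "(1 / sqrt 3) *\<^sub>R f b = \<phi> b" if "b \<in> std_tet" for b
  proof -
    have "(\<Sum>a\<in>std_tet. (a \<bullet> b) *\<^sub>R \<phi> a) = (b \<bullet> b) *\<^sub>R \<phi> b + (\<Sum>a\<in>std_tet - {b}. (a \<bullet> b) *\<^sub>R \<phi> a)"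
      by (rule sum.remove[OF ftet that])
    also have "(\<Sum>a\<in>std_tet - {b}. (a \<bullet> b) *\<^sub>R \<phi> a) = (\<Sum>a\<in>std_tet - {b}. - \<phi> a)"
      using tin that by (intro sum.cong) auto
    also have "\<dots> = - (\<Sum>a\<in>std_tet. \<phi> a) + \<phi> b"
      using ftet that by (simp add: sum_negf sum_diff1)
    also have "(\<Sum>a\<in>std_tet. \<phi> a) = 0" using sum.reindex_bij_betw[OF \<phi>, of "\<lambda>x. x"] sumC by simp
    finally have "(\<Sum>a\<in>std_tet. (a \<bullet> b) *\<^sub>R \<phi> a) = 4 *\<^sub>R \<phi> b"
      using tin[OF that that] by (simp add: vec_eq_iff)
    then show ?thesis by (simp add: f_def)
  qed
  have "vertices S = (\<lambda>x. (1 / sqrt 3) *\<^sub>R f x) ` std_tet"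
    using \<phi> f\<phi> by (simp add: V bij_betw_def)
  with orth show ?thesis by (rule that)
qed

lemma inverse_sqrt3_cubed: "(1 / sqrt 3) ^ 3 = 1 / (3 * sqrt 3)"
  by (simp add: power3_eq_cube)

lemma volume_two_inscribed_tetrahedra:
  assumes S: "regular_tetrahedron S" "inscribed_in_unit_sphere S"
    and T: "regular_tetrahedron T" "inscribed_in_unit_sphere T"
  shows "measure lebesgue (convex hull (vertices S \<union> vertices T)) \<le> 8 / (3 * sqrt 3)"
proof -
  obtain f where f: "orthogonal_transformation f" "vertices S = (\<lambda>x. (1 / sqrt 3) *\<^sub>R f x) ` std_tet"
    by (rule regular_tetrahedron_inscribed[OF S])
  obtain g where g: "orthogonal_transformation g" "vertices T = (\<lambda>x. (1 / sqrt 3) *\<^sub>R g x) ` std_tet"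
    by (rule regular_tetrahedron_inscribed[OF T])
  define h where "h = inv f \<circ> g"
  have h: "orthogonal_transformation h"
    unfolding h_def using f(1) g(1)
    by (intro orthogonal_transformation_compose orthogonal_transformation_inv)
  have fh: "f (h x) = g x" for x
    unfolding h_def using orthogonal_transformation_surj[OF f(1)] by (simp add: surj_f_inv_f)
  let ?H = "convex hull (std_tet \<union> h ` std_tet)"
  have lin: "linear f" "linear (\<lambda>x::real^3. (1 / sqrt 3) *\<^sub>R x)"
    using f(1) by (simp_all add: orthogonal_transformation_linear linear_scaleR)
  have m: "?H \<in> lmeasurable" by (rule lmeasurable_hull_finite) (simp add: std_tet_def)
  have "vertices S \<union> vertices T = (\<lambda>x. (1 / sqrt 3) *\<^sub>R x) ` f ` (std_tet \<union> h ` std_tet)"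
    by (simp add: f(2) g(2) image_Un image_image fh)
  then have "convex hull (vertices S \<union> vertices T) = (\<lambda>x. (1 / sqrt 3) *\<^sub>R x) ` f ` ?H"
    by (simp add: convex_hull_linear_image lin)
  then have "measure lebesgue (convex hull (vertices S \<union> vertices T)) = (1 / sqrt 3) ^ 3 * measure lebesgue ?H"
    using measure_scaleR_image[OF measurable_orthogonal_image[OF f(1) m]] measure_orthogonal_image[OF f(1) m]
    by simp
  also have "\<dots> \<le> (1 / sqrt 3) ^ 3 * 8"
    by (intro mult_left_mono measure_hull_std_tet_orthogonal_image h) simp
  also have "\<dots> = 8 / (3 * sqrt 3)" by (simp add: inverse_sqrt3_cubed)
  finally show ?thesis .
qed

lemma extreme_point_cbox_01:
  fixes c :: "real^3"
  assumes "\<And>i. c$i \<in> {0, 1}"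
  shows "c extreme_point_of cbox 0 1"
  unfolding extreme_point_of_def
proof (intro conjI ballI notI)
  show "c \<in> cbox 0 1" unfolding mem_box_cart
  proof
    fix i show "0 $ i \<le> c $ i \<and> c $ i \<le> 1 $ i" using assms[of i] by auto
  qed
  fix a b :: "real^3" assume a: "a \<in> cbox 0 1" and b: "b \<in> cbox 0 1" and "c \<in> open_segment a b"
  then obtain u where u: "a \<noteq> b" "0 < u" "u < 1" "c = (1 - u) *\<^sub>R a + u *\<^sub>R b" by (auto simp: in_segment)
  have "a $ i = b $ i" for i
  proof -
    have ab: "0 \<le> a$i" "a$i \<le> 1" "0 \<le> b$i" "b$i \<le> 1" using a b by (auto simp: mem_box_cart)
    have ci: "c$i = (1 - u) * a$i + u * b$i" by (simp add: u(4))
    show ?thesis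
    proof (cases "c$i = 0")
      case True
      have "0 \<le> (1 - u) * a$i" "0 \<le> u * b$i" using ab u by auto
      then have "(1 - u) * a$i = 0" "u * b$i = 0" using ci True by linarith+
      then show ?thesis using u by auto
    next
      case False
      then have "c$i = 1" using assms[of i] by auto
      moreover have "0 \<le> (1 - u) * (1 - a$i)" "0 \<le> u * (1 - b$i)" using ab u by auto
      moreover have "(1 - u) * (1 - a$i) + u * (1 - b$i) = 1 - c$i" by (simp add: ci algebra_simps)
      ultimately have "(1 - u) * (1 - a$i) = 0" "u * (1 - b$i) = 0" by linarith+
      then show ?thesis using u by auto
    qed
  qed
  then show False using u(1) by (simp add: vec_eq_iff)
qed

text \<open>The corners are vertices of the cube in the sense of extreme points, hence lie on the sphere.\<close>

lemma inscribed_cube_corner: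
  assumes f: "orthogonal_transformation f" and s: "0 < s"
    and C: "C = (\<lambda>x. p + s *\<^sub>R f x) ` cbox (0::real^3) 1" and ins: "inscribed_in_unit_sphere C"
    and c: "\<And>i. c$i \<in> {0, 1}"
  shows "norm (p + s *\<^sub>R f c) = 1"
proof -
  let ?g = "\<lambda>x. s *\<^sub>R f x"
  have lin: "linear ?g" using f by (intro linear_compose_scale_right orthogonal_transformation_linear)
  have inj: "inj ?g" using orthogonal_transformation_inj[OF f] s by (simp add: inj_on_def)
  have "{c} face_of cbox 0 1" using extreme_point_cbox_01[OF c] by (simp add: face_of_singleton)
  then have "?g ` {c} face_of ?g ` cbox 0 1" by (simp only: face_of_linear_image[OF lin inj])
  then have "?g c extreme_point_of ?g ` cbox 0 1" by (simp add: face_of_singleton)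
  then have "(p + ?g c) extreme_point_of (+) p ` ?g ` cbox 0 1" by (simp only: extreme_point_of_translation_eq)
  then have "p + ?g c \<in> vertices C" by (simp add: vertices_def C image_image)
  then show ?thesis using ins unfolding inscribed_in_unit_sphere_def by auto
qed

lemma measure_cube:
  fixes f :: "real^3 \<Rightarrow> real^3"
  assumes f: "orthogonal_transformation f" and s: "0 < s"
  shows "measure lebesgue ((\<lambda>x. p + s *\<^sub>R f x) ` cbox (0::real^3) 1) = s ^ 3"
proof -
  have m: "cbox (0::real^3) 1 \<in> lmeasurable" by simp
  have "(\<lambda>x. p + s *\<^sub>R f x) ` cbox (0::real^3) 1 = (+) p ` (\<lambda>x. s *\<^sub>R x) ` f ` cbox 0 1"
    by (simp add: image_image)
  moreover have "measure lebesgue (cbox (0::real^3) 1) = 1"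
  proof -
    have "0 \<in> cbox (0::real^3) 1" by (simp add: mem_box_cart)
    then have "cbox (0::real^3) 1 \<noteq> {}" by blast
    then show ?thesis using content_cbox_cart[of "0::real^3" 1] by simp
  qed
  ultimately show ?thesis
    using s by (simp add: measure_translation measure_scaleR_image[OF measurable_orthogonal_image[OF f m]]
        measure_orthogonal_image[OF f m])
qed

text \<open>The corner \<open>p\<close> and its three neighbours on the unit sphere determine the inner products of \<open>p\<close> with the edge directions, and
thereby the edge length.\<close>

lemma measure_inscribed_cube:
  assumes "is_cube C" "inscribed_in_unit_sphere C"
  shows "measure lebesgue C = 8 / (3 * sqrt 3)"
proof -
  obtain f p s where f: "orthogonal_transformation f" and s: "0 < s"
    and C: "C = (\<lambda>x. p + s *\<^sub>R f x) ` cbox (0::real^3) 1"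
    using assms(1) unfolding is_cube_def by blast
  note corner = inscribed_cube_corner[OF f s C assms(2)]
  have lin: "linear f" and ff: "\<And>x y. f x \<bullet> f y = x \<bullet> y"
    using f by (auto simp: orthogonal_transformation_def)
  have nsq: "p \<bullet> p + 2 * s * (p \<bullet> f c) + s\<^sup>2 * (c \<bullet> c) = 1" if "\<And>i. c$i \<in> {0, 1}" for c
  proof -
    have "(p + s *\<^sub>R f c) \<bullet> (p + s *\<^sub>R f c) = 1" using corner[OF that] by (simp add: norm_eq_1)
    then show ?thesis by (simp add: algebra_simps inner_commute ff power2_eq_square)
  qed
  have p1: "p \<bullet> p = 1" using nsq[of 0] by (simp add: linear_0[OF lin])
  have ax: "axis i (1::real) $ j \<in> {0, 1}" for i j :: 3 by (simp add: axis_def)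
  have pe: "p \<bullet> f (axis i 1) = - s / 2" for i
  proof -
    have "2 * s * (p \<bullet> f (axis i 1)) + s\<^sup>2 = 0"
      using nsq[of "axis i 1", OF ax] p1 by (simp add: inner_axis_axis)
    then have "s * (2 * (p \<bullet> f (axis i 1)) + s) = 0" by (simp add: power2_eq_square algebra_simps)
    then show ?thesis using s by simp
  qed
  obtain q where q: "p = f q" using orthogonal_transformation_surj[OF f] by (metis surjD)
  have "q $ i = - s / 2" for i using pe[of i] by (simp add: q ff inner_axis)
  moreover have "q \<bullet> q = 1" using p1 by (simp add: q ff)
  ultimately have "3 * (s\<^sup>2 / 4) = 1" by (simp add: inner_vec_def sum_3 power2_eq_square)
  then have "s\<^sup>2 = (2 / sqrt 3)\<^sup>2" by (simp add: power_divide)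
  then have "s = 2 / sqrt 3" using s by (simp add: power2_eq_iff_nonneg)
  then show ?thesis using measure_cube[OF f s, of p] by (simp add: C power_divide power3_eq_cube)
qed

text \<open>A point of the cube with some coordinate strictly between \<open>-1\<close> and \<open>1\<close> is the midpoint of a segment in that direction, so
the extreme points have coordinates \<open>\<plusminus>1\<close>.\<close>

lemma convex_hull_std_tet_opposite: "convex hull (std_tet \<union> uminus ` std_tet) = cbox (-1) 1"
proof
  have neg: "- vector [a, b, c] = (vector [-a, -b, -c] :: real^3)" for a b c
    by (simp add: vec_eq_iff forall_3)
  have "std_tet \<union> uminus ` std_tet \<subseteq> cbox (-1) 1"
    by (simp add: std_tet_def neg mem_box_cart forall_3)
  then show "convex hull (std_tet \<union> uminus ` std_tet) \<subseteq> cbox (-1) 1"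
    by (rule hull_minimal) (rule convex_box)
  have "x \<in> std_tet \<union> uminus ` std_tet" if x: "x extreme_point_of cbox (-1) 1" for x :: "real^3"
  proof -
    have mem: "x \<in> cbox (-1) 1" using x by (simp add: extreme_point_of_def)
    have cases: "x $ i = 1 \<or> x $ i = - 1" for i
    proof (rule ccontr)
      assume n: "\<not> (x $ i = 1 \<or> x $ i = - 1)"
      have b: "- 1 \<le> x $ j" "x $ j \<le> 1" for j using mem by (simp_all add: mem_box_cart)
      define e where "e = min (1 - x$i) (x$i + 1)"
      have e: "0 < e" "e \<le> 1 - x$i" "e \<le> x$i + 1"
        using b[of i] n by (auto simp: e_def)
      have "- 1 \<le> (x + e *\<^sub>R axis i 1) $ j \<and> (x + e *\<^sub>R axis i 1) $ j \<le> 1"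
        "- 1 \<le> (x - e *\<^sub>R axis i 1) $ j \<and> (x - e *\<^sub>R axis i 1) $ j \<le> 1" for j
        by (cases "j = i"; use b[of j] e in \<open>simp add: axis_def\<close>)+
      then have "x + e *\<^sub>R axis i 1 \<in> cbox (-1) 1" "x - e *\<^sub>R axis i 1 \<in> cbox (-1) 1"
        unfolding mem_box_cart by simp_all
      moreover have "x \<in> open_segment (x - e *\<^sub>R axis i 1) (x + e *\<^sub>R axis i 1)"
      proof -
        have "x = (1 - 1/2) *\<^sub>R (x - e *\<^sub>R axis i 1) + (1/2) *\<^sub>R (x + e *\<^sub>R axis i 1)"
          by (simp add: vec_eq_iff field_simps)
        moreover have "(x - e *\<^sub>R axis i 1) $ i \<noteq> (x + e *\<^sub>R axis i 1) $ i" using e by simp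
        then have "x - e *\<^sub>R axis i 1 \<noteq> x + e *\<^sub>R axis i 1" by metis
        ultimately show ?thesis unfolding in_segment by (intro conjI exI[of _ "1/2"]) simp_all
      qed
      ultimately show False using x unfolding extreme_point_of_def by blast
    qed
    have "x = vector [x$1, x$2, x$3]" by (simp add: vec_eq_iff forall_3)
    then show ?thesis
      using cases[of 1] cases[of 2] cases[of 3] by (elim disjE) (simp_all add: std_tet_def neg)
  qed
  then have "{x. x extreme_point_of cbox (-1) (1::real^3)} \<subseteq> std_tet \<union> uminus ` std_tet" by blast
  then show "cbox (-1) 1 \<subseteq> convex hull (std_tet \<union> uminus ` std_tet)"
    by (subst Krein_Milman_Minkowski[OF compact_cbox convex_box(1)]) (rule hull_mono)
qed

lemma regular_tetrahedron_scaled_std_tet: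
  assumes c: "\<bar>c\<bar> = 1 / sqrt 3"
  defines "S \<equiv> convex hull ((\<lambda>x. c *\<^sub>R x) ` std_tet)"
  shows "regular_tetrahedron S" "inscribed_in_unit_sphere S" "vertices S = (\<lambda>x. c *\<^sub>R x) ` std_tet"
proof -
  have c0: "c \<noteq> 0" using c by auto
  have lin: "linear (\<lambda>x::real^3. c *\<^sub>R x)" by (simp add: linear_scaleR)
  have inj: "inj (\<lambda>x::real^3. c *\<^sub>R x)" using c0 by (simp add: inj_on_def)
  have ind: "\<not> affine_dependent ((\<lambda>x. c *\<^sub>R x) ` std_tet)"
    using affine_independent_std_tet unfolding affine_independent_iff_card
    by (simp add: aff_dim_injective_linear_image[OF lin inj] card_image[OF inj_on_subset[OF inj subset_UNIV]])
  have card: "card ((\<lambda>x. c *\<^sub>R x) ` std_tet) = 4"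
    using card_image[of "\<lambda>x. c *\<^sub>R x" std_tet] inj card_std_tet by (simp add: inj_on_subset)
  show V: "vertices S = (\<lambda>x. c *\<^sub>R x) ` std_tet"
    using extreme_point_of_convex_hull_affine_independent[OF ind] by (simp add: vertices_def S_def)
  have "3 simplex S" unfolding simplex_def S_def using ind card by (intro exI[of _ "(\<lambda>x. c *\<^sub>R x) ` std_tet"]) simp
  moreover have "dist (c *\<^sub>R a) (c *\<^sub>R b) = \<bar>c\<bar> * sqrt 8" if "a \<in> std_tet" "b \<in> std_tet" "a \<noteq> b" for a b
  proof -
    have "(a - b) \<bullet> (a - b) = 8" using that by (auto simp: std_tet_def inner_vec_def sum_3)
    then have "norm (a - b) = sqrt 8" by (simp add: norm_eq_sqrt_inner)
    moreover have "dist (c *\<^sub>R a) (c *\<^sub>R b) = \<bar>c\<bar> * norm (a - b)"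
      by (simp add: dist_norm flip: scaleR_diff_right)
    ultimately show ?thesis by simp
  qed
  then have "\<forall>x\<in>vertices S. \<forall>y\<in>vertices S. x \<noteq> y \<longrightarrow> dist x y = \<bar>c\<bar> * sqrt 8" unfolding V by blast
  ultimately show "regular_tetrahedron S" unfolding regular_tetrahedron_def by blast
  have "norm (c *\<^sub>R a) = 1" if "a \<in> std_tet" for a
  proof -
    have "norm a = sqrt 3" using that by (auto simp: std_tet_def norm_eq_sqrt_inner inner_vec_def sum_3)
    then show ?thesis using c by simp
  qed
  moreover have "polytope S" unfolding S_def by (rule polytope_convex_hull) (simp add: std_tet_def)
  ultimately show "inscribed_in_unit_sphere S" unfolding inscribed_in_unit_sphere_def V by auto
qed

lemma opposite_tetrahedra_attain:
  obtains S T where "regular_tetrahedron S" "inscribed_in_unit_sphere S"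
    "regular_tetrahedron T" "inscribed_in_unit_sphere T"
    "measure lebesgue (convex hull (vertices S \<union> vertices T)) = 8 / (3 * sqrt 3)"
proof -
  define c where "c = 1 / sqrt 3"
  have c: "\<bar>c\<bar> = 1 / sqrt 3" "\<bar>- c\<bar> = 1 / sqrt 3" by (simp_all add: c_def)
  note S = regular_tetrahedron_scaled_std_tet[OF c(1)] and T = regular_tetrahedron_scaled_std_tet[OF c(2)]
  have "(\<lambda>x. c *\<^sub>R x) ` std_tet \<union> (\<lambda>x. (- c) *\<^sub>R x) ` std_tet = (\<lambda>x. c *\<^sub>R x) ` (std_tet \<union> uminus ` std_tet)"
    by (simp add: image_Un image_image)
  then have "convex hull ((\<lambda>x. c *\<^sub>R x) ` std_tet \<union> (\<lambda>x. (- c) *\<^sub>R x) ` std_tet) = (\<lambda>x. c *\<^sub>R x) ` cbox (-1) 1"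
    by (simp add: convex_hull_scaling convex_hull_std_tet_opposite)
  moreover have "measure lebesgue (cbox (-1) (1::real^3)) = 8"
  proof -
    have "0 \<in> cbox (-1) (1::real^3)" by (simp add: mem_box_cart)
    then have "cbox (-1) (1::real^3) \<noteq> {}" by blast
    then show ?thesis using content_cbox_cart[of "-1::real^3" 1] by simp
  qed
  ultimately have "measure lebesgue (convex hull ((\<lambda>x. c *\<^sub>R x) ` std_tet \<union> (\<lambda>x. (- c) *\<^sub>R x) ` std_tet)) = 8 * (1 / sqrt 3) ^ 3"
    using measure_scaleR_image[of "cbox (-1) 1" c] c(1) by simp
  then have M: "measure lebesgue (convex hull ((\<lambda>x. c *\<^sub>R x) ` std_tet \<union> (\<lambda>x. (- c) *\<^sub>R x) ` std_tet)) = 8 / (3 * sqrt 3)"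
    unfolding inverse_sqrt3_cubed by simp
  show ?thesis by (rule that[OF S(1,2) T(1,2)]) (simp only: S(3) T(3) M)
qed

lemma inscribed_cube_exists: "\<exists>C. is_cube C \<and> inscribed_in_unit_sphere C"
proof -
  define c where "c = 1 / sqrt 3"
  let ?C = "(\<lambda>x. c *\<^sub>R x) ` cbox (-1) (1::real^3)"
  have c0: "0 < c" by (simp add: c_def)
  have "cbox (-1) (1::real^3) = (\<lambda>x. - 1 + 2 *\<^sub>R x) ` cbox 0 1"
  proof (intro subset_antisym subsetI)
    fix x :: "real^3" assume "x \<in> cbox (-1) 1"
    then have "- 1 \<le> x$i" "x$i \<le> 1" for i by (simp_all add: mem_box_cart)
    then have "(1/2) *\<^sub>R (x + 1) \<in> cbox 0 1" by (simp add: mem_box_cart) (metis add.commute diff_ge_0_iff_ge diff_minus_eq_add)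
    moreover have "x = - 1 + 2 *\<^sub>R ((1/2) *\<^sub>R (x + 1))" by simp
    ultimately show "x \<in> (\<lambda>x. - 1 + 2 *\<^sub>R x) ` cbox 0 1" by blast
  next
    fix x :: "real^3" assume "x \<in> (\<lambda>x. - 1 + 2 *\<^sub>R x) ` cbox 0 1"
    then show "x \<in> cbox (-1) 1" by (auto simp: mem_box_cart)
  qed
  then have "?C = (\<lambda>x. - (c *\<^sub>R 1) + (2 * c) *\<^sub>R id x) ` cbox 0 1"
    by (simp add: image_image scaleR_diff_right mult.commute)
  then have "is_cube ?C"
    unfolding is_cube_def using c0
    by (intro exI[of _ id] exI[of _ "- (c *\<^sub>R 1)"] exI[of _ "2 * c"]) (simp add: orthogonal_transformation_def linear_id)
  moreover have "inscribed_in_unit_sphere ?C"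
  proof -
    have H: "?C = convex hull ((\<lambda>x. c *\<^sub>R x) ` (std_tet \<union> uminus ` std_tet))"
      by (simp only: convex_hull_scaling convex_hull_std_tet_opposite)
    have "norm (c *\<^sub>R a) = 1" if "a \<in> std_tet" for a
    proof -
      have "norm a = sqrt 3" using that by (auto simp: std_tet_def norm_eq_sqrt_inner inner_vec_def sum_3)
      then show ?thesis by (simp add: c_def)
    qed
    then have "(\<lambda>x. c *\<^sub>R x) ` (std_tet \<union> uminus ` std_tet) \<subseteq> sphere 0 1" by auto
    moreover have "vertices ?C \<subseteq> (\<lambda>x. c *\<^sub>R x) ` (std_tet \<union> uminus ` std_tet)"
      unfolding vertices_def H using extreme_points_of_convex_hull by blast
    moreover have "polytope ?C" unfolding H by (rule polytope_convex_hull) (simp add: std_tet_def)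
    ultimately show ?thesis unfolding inscribed_in_unit_sphere_def by blast
  qed
  ultimately show ?thesis by blast
qed

theorem theorem2:
  "(\<exists>C. is_cube C \<and> inscribed_in_unit_sphere C) \<and>
   (\<forall>C. is_cube C \<and> inscribed_in_unit_sphere C \<longrightarrow>
      (\<forall>S T. regular_tetrahedron S \<and> inscribed_in_unit_sphere S \<and>
             regular_tetrahedron T \<and> inscribed_in_unit_sphere T \<longrightarrow>
             measure lebesgue (convex hull (vertices S \<union> vertices T)) \<le> measure lebesgue C) \<and>
      (\<exists>S T. regular_tetrahedron S \<and> inscribed_in_unit_sphere S \<and>
             regular_tetrahedron T \<and> inscribed_in_unit_sphere T \<and>
             measure lebesgue (convex hull (vertices S \<union> vertices T)) = measure lebesgue C) \<and>
      measure lebesgue C = 8 / (3 * sqrt 3))"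
proof (intro conjI allI impI)
  show "\<exists>C. is_cube C \<and> inscribed_in_unit_sphere C" by (rule inscribed_cube_exists)
next
  fix C assume "is_cube C \<and> inscribed_in_unit_sphere C"
  then show C: "measure lebesgue C = 8 / (3 * sqrt 3)" by (intro measure_inscribed_cube) auto
  show "\<exists>S T. regular_tetrahedron S \<and> inscribed_in_unit_sphere S \<and>
      regular_tetrahedron T \<and> inscribed_in_unit_sphere T \<and>
      measure lebesgue (convex hull (vertices S \<union> vertices T)) = measure lebesgue C"
    unfolding C using opposite_tetrahedra_attain by metis
  fix S T assume "regular_tetrahedron S \<and> inscribed_in_unit_sphere S \<and>
      regular_tetrahedron T \<and> inscribed_in_unit_sphere T"
  then show "measure lebesgue (convex hull (vertices S \<union> vertices T)) \<le> measure lebesgue C"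
    unfolding C by (intro volume_two_inscribed_tetrahedra) auto
qed

end
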